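(* Let $1\le p<q<\infty$. Then $\mathcal U_p(\mathbb{R}^2)\subset\mathcal U_q(\mathbb{R}^2)$, and there is a constant $c>0$ depending only on $p$ and $q$ such that for every $f\in\mathcal U_p(\mathbb{R}^2)$, $$\|f\|_{\mathcal U_q(\mathbb{R}^2)}\le c\,\|f\|_{\mathcal U_p(\mathbb{R}^2)}.$$
   Context: For a function $f$ on $\mathbb{R}^2$, $f_x(y)=f(x,y)$ and $f_y(x)=f(x,y)$ denote the sections. For $\varphi$ on $\mathbb{R}$, $\Delta_h\varphi(t)=\varphi(t+h)-\varphi(t)$; for $\alpha\in(0,1]$, $\operatorname{Lip}\alpha$ is the class of $\varphi\in L^\infty(\mathbb{R})$ with $\|\varphi\|^*_{\operatorname{Lip}\alpha}=\sup_{h>0}h^{-\alpha}\|\Delta_h\varphi\|_\infty<\infty$ ($\|\cdot\|_\infty$ the essential supremum), and $\|\varphi\|_{\operatorname{Lip}\alpha}=\|\varphi\|_\infty+\|\varphi\|^*_{\operatorname{Lip}\alpha}$. $S_0(\mathbb{R}^n)$ is the class of measurable a.e. finite $g$ with $|\{|g|>s\}|<\infty$ for all $s>0$; $g^*$ denotes the non-increasing rearrangement on $(0,\infty)$, and $L^{p,1}(\mathbb{R})$ is the set of $g\in S_0(\mathbb{R})$ with $\|g\|_{L^{p,1}}=\int_0^\infty t^{1/p-1}g^*(t)\,dt<\infty$. For $1\le p<\infty$, $\mathcal U_p(\mathbb{R}^2)$ is the set of measurable $f$ on $\mathbb{R}^2$ such that almost every $x$-section and almost every $y$-section belong to $\operatorname{Lip}\frac1p$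 and the functions $y\mapsto\|f_y\|_{\operatorname{Lip}\frac1p}$ and $x\mapsto\|f_x\|_{\operatorname{Lip}\frac1p}$ belong to $L^{p,1}(\mathbb{R})$, with norm $\|f\|_{\mathcal U_p}=\|y\mapsto\|f_y\|_{\operatorname{Lip}\frac1p}\|_{L^{p,1}}+\|x\mapsto\|f_x\|_{\operatorname{Lip}\frac1p}\|_{L^{p,1}}$. *)

theory Defs
  imports "HOL-Analysis.Analysis" "HOL-Probability.Essential_Supremum"
begin

definition linf_norm :: "(real \<Rightarrow> real) \<Rightarrow> ereal" where
  "linf_norm \<phi> = esssup lebesgue (\<lambda>t. ereal \<bar>\<phi> t\<bar>)"

definition diff_op :: "real \<Rightarrow> (real \<Rightarrow> real) \<Rightarrow> real \<Rightarrow> real" where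
  "diff_op h \<phi> t = \<phi> (t + h) - \<phi> t"

definition lip_seminorm :: "real \<Rightarrow> (real \<Rightarrow> real) \<Rightarrow> ereal" where
  "lip_seminorm \<alpha> \<phi> = (SUP h\<in>{0<..}. ereal (h powr (- \<alpha>)) * linf_norm (diff_op h \<phi>))"

definition in_Lip :: "real \<Rightarrow> (real \<Rightarrow> real) \<Rightarrow> bool" where
  "in_Lip \<alpha> \<phi> \<longleftrightarrow> \<phi> \<in> borel_measurable lebesgue \<and> linf_norm \<phi> < \<infinity> \<and> lip_seminorm \<alpha> \<phi> < \<infinity>"

definition lip_norm :: "real \<Rightarrow> (real \<Rightarrow> real) \<Rightarrow> real" where
  "lip_norm \<alpha> \<phi> = real_of_ereal (linf_norm \<phi> + lip_seminorm \<alpha> \<phi>)"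

definition distrib_fun :: "(real \<Rightarrow> real) \<Rightarrow> real \<Rightarrow> ennreal" where
  "distrib_fun g s = emeasure lebesgue {t. s < \<bar>g t\<bar>}"

definition in_S0 :: "(real \<Rightarrow> real) \<Rightarrow> bool" where
  "in_S0 g \<longleftrightarrow> g \<in> borel_measurable lebesgue \<and> (\<forall>s>0. distrib_fun g s < \<infinity>)"

definition rearr :: "(real \<Rightarrow> real) \<Rightarrow> real \<Rightarrow> real" where
  "rearr g t = Inf {s. 0 \<le> s \<and> distrib_fun g s \<le> ennreal t}"

definition lorentz_p1_norm :: "real \<Rightarrow> (real \<Rightarrow> real) \<Rightarrow> ennreal" where
  "lorentz_p1_norm p g =
     (\<integral>\<^sup>+ t. indicator {0<..} t * ennreal (t powr (1 / p - 1) * rearr g t) \<partial>lborel)"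

definition in_Lp1 :: "real \<Rightarrow> (real \<Rightarrow> real) \<Rightarrow> bool" where
  "in_Lp1 p g \<longleftrightarrow> in_S0 g \<and> lorentz_p1_norm p g < \<infinity>"

definition in_U :: "real \<Rightarrow> (real \<times> real \<Rightarrow> real) \<Rightarrow> bool" where
  "in_U p f \<longleftrightarrow>
     f \<in> borel_measurable lebesgue \<and>
     (AE x in lebesgue. in_Lip (1 / p) (\<lambda>y. f (x, y))) \<and>
     (AE y in lebesgue. in_Lip (1 / p) (\<lambda>x. f (x, y))) \<and>
     in_Lp1 p (\<lambda>y. lip_norm (1 / p) (\<lambda>x. f (x, y))) \<and>
     in_Lp1 p (\<lambda>x. lip_norm (1 / p) (\<lambda>y. f (x, y)))"

definition U_norm :: "real \<Rightarrow> (real \<times> real \<Rightarrow> real) \<Rightarrow> ennreal" where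
  "U_norm p f =
     lorentz_p1_norm p (\<lambda>y. lip_norm (1 / p) (\<lambda>x. f (x, y))) +
     lorentz_p1_norm p (\<lambda>x. lip_norm (1 / p) (\<lambda>y. f (x, y)))"

end

theory Submission
  imports Defs
begin

text \<open>
  Write \<open>\<alpha> = 1/p\<close>, \<open>\<beta> = 1/q\<close>, \<open>d = \<alpha> - \<beta>\<close>, and let \<open>\<phi>\<close>, \<open>\<psi>\<close> be the \<open>Lip \<alpha>\<close> norms of the
  \<open>x\<close>- and \<open>y\<close>-sections of \<open>f\<close>, with rearrangements \<open>\<phi>*\<close>, \<open>\<psi>*\<close> and \<open>\<Phi> = \<phi>* + \<psi>*\<close>.
  Let \<open>\<phi> x \<le> \<phi>* s\<close>; this excludes a set of measure at most \<open>s\<close>. From a point \<open>(x, y)\<close>, move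
  \<open>y\<close> by at most \<open>s\<close> to a point where \<open>\<psi> \<le> \<psi>* s\<close>, then \<open>x\<close> by at most \<open>2s\<close> to a point where
  \<open>\<phi> \<le> \<phi>* (2s)\<close>; such points exist because an exceptional set cannot contain an interval
  longer than its measure. The step changes \<open>f\<close> by at most \<open>2 s\<^sup>\<alpha> \<Phi> s\<close>. Iterating at the
  scales \<open>2\<^sup>k s\<close>, up to the scale \<open>h\<close> for an increment by \<open>h\<close> and up to the scale \<open>1\<close> for the
  supremum, bounds the \<open>Lip \<beta>\<close> norm of the section at \<open>x\<close> by \<open>10 A(s)\<close>, where \<open>A(s)\<close> is the
  sum of \<open>(2\<^sup>k s)\<^sup>d \<Phi> (2\<^sup>k s)\<close> over all \<open>k\<close>. So \<open>10 A\<close> dominates the rearrangement of that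
  norm, and scaling turns the integral of \<open>s powr (\<beta> - 1) * A s\<close> into a geometric series with
  ratio \<open>2 powr (- \<beta>)\<close> times the integral of \<open>t powr (\<alpha> - 1) * \<Phi> t\<close>, which is the norm of \<open>f\<close>.
\<close>

section \<open>Translation and Fubini for almost-everywhere statements\<close>

lemma AE_lborel_shift:
  fixes h :: real
  assumes "AE t in lborel. P t"
  shows "AE t in lborel. P (t + h)"
proof -
  have "AE t in distr lborel borel ((+) h). P t"
    using assms by (subst lborel_distr_plus)
  from AE_distrD[OF _ this] show ?thesis by (simp add: add.commute)
qed

text \<open>\<open>P\<close> need not be measurable, so Fubini is applied to avoidance of a Borel
  null set \<open>N\<close> that contains the exceptional set.\<close>

lemma AE_lborel_prodD:
  fixes P :: "real \<times> real \<Rightarrow> bool"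
  assumes "AE z in lborel. P z"
  shows "AE x in lborel. AE y in lborel. P (x, y)" "AE y in lborel. AE x in lborel. P (x, y)"
proof -
  from assms obtain N where N: "{z. \<not> P z} \<subseteq> N" "N \<in> null_sets (lborel :: (real \<times> real) measure)"
    unfolding eventually_ae_filter by auto
  have "AE z in lborel \<Otimes>\<^sub>M lborel. z \<notin> N"
    using N(2) by (simp add: lborel_prod AE_not_in)
  from lborel_pair.AE_pair[OF this]
  have *: "AE x in lborel. AE y in lborel. (x, y) \<notin> N" .
  then show "AE x in lborel. AE y in lborel. P (x, y)"
    using N(1) by (force elim!: eventually_mono)
  have N': "N \<in> sets borel" using N(2) by auto
  have "{z \<in> space (lborel \<Otimes>\<^sub>M lborel). (fst z, snd z) \<notin> N} \<in> sets ((lborel::real measure) \<Otimes>\<^sub>M (lborel::real measure))"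
    using borel_comp[OF N'] by (simp add: Compl_eq[symmetric] space_pair_measure flip: borel_prod)
  from lborel_pair.AE_commute[OF this] *
  have "AE y in lborel. AE x in lborel. (x, y) \<notin> N" by simp
  then show "AE y in lborel. AE x in lborel. P (x, y)"
    using N(1) by (force elim!: eventually_mono)
qed

text \<open>The measure of the exceptional section is a measurable function of the parameter, and
  the predicate says that this measure vanishes.\<close>

lemma pred_AE_lborel:
  fixes P :: "'a \<Rightarrow> real \<Rightarrow> bool"
  assumes "Measurable.pred (M \<Otimes>\<^sub>M borel) (\<lambda>w. P (fst w) (snd w))"
  shows "Measurable.pred M (\<lambda>z. AE t in lborel. P z t)"
proof -
  let ?Q = "{w \<in> space (M \<Otimes>\<^sub>M lborel). \<not> P (fst w) (snd w)}"
  have [measurable]: "Measurable.pred (M \<Otimes>\<^sub>M lborel) (\<lambda>w. P (fst w) (snd w))"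
    using assms by simp
  have Q: "?Q \<in> sets (M \<Otimes>\<^sub>M lborel)" by measurable
  have [measurable]: "(\<lambda>z. emeasure lborel (Pair z -` ?Q)) \<in> borel_measurable M"
    by (rule lborel.measurable_emeasure_Pair[OF Q])
  have "Measurable.pred M (\<lambda>z. emeasure lborel (Pair z -` ?Q) = 0)"
    by measurable
  moreover have "(AE t in lborel. P z t) \<longleftrightarrow> emeasure lborel (Pair z -` ?Q) = 0" if "z \<in> space M" for z
    using sets_Pair1[OF Q, of z] that
    by (subst AE_iff_measurable[OF _ refl]) (auto simp: vimage_def space_pair_measure)
  ultimately show ?thesis by (simp cong: measurable_cong)
qed

lemma borel_prod_AE_commute:
  fixes P :: "real \<Rightarrow> real \<Rightarrow> bool"
  assumes "Measurable.pred (borel \<Otimes>\<^sub>M borel) (\<lambda>z. P (fst z) (snd z))"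
  shows "(AE x in lborel. AE y in lborel. P x y) \<longleftrightarrow> (AE y in lborel. AE x in lborel. P x y)"
  using assms by (intro lborel_pair.AE_commute) (simp add: pred_def space_pair_measure)

section \<open>Essential suprema and Lipschitz norms\<close>

lemma linf_norm_nonneg: "0 \<le> linf_norm \<phi>"
proof (cases "(\<lambda>t. ereal \<bar>\<phi> t\<bar>) \<in> borel_measurable lebesgue")
  case True
  have "esssup lebesgue (\<lambda>t::real. 0::ereal) \<le> linf_norm \<phi>"
    unfolding linf_norm_def by (intro esssup_mono) auto
  then show ?thesis by (simp add: esssup_const)
\<comment> \<open>For a nonmeasurable function \<open>esssup\<close> has the default value infinity,
  so nonnegativity survives there.\<close>
qed (simp add: linf_norm_def esssup_def top_ereal_def)

lemma linf_norm_le_iff: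
  assumes "\<phi> \<in> borel_measurable lebesgue"
  shows "linf_norm \<phi> \<le> ereal c \<longleftrightarrow> (AE t in lborel. \<bar>\<phi> t\<bar> \<le> c)"
proof
  assume c: "linf_norm \<phi> \<le> ereal c"
  have "AE t in lebesgue. ereal \<bar>\<phi> t\<bar> \<le> linf_norm \<phi>"
    unfolding linf_norm_def by (rule esssup_AE)
  then have "AE t in lebesgue. \<bar>\<phi> t\<bar> \<le> c"
    by (elim eventually_mono) (use c order_trans in fastforce)
  then show "AE t in lborel. \<bar>\<phi> t\<bar> \<le> c" by (simp add: AE_completion_iff)
next
  assume "AE t in lborel. \<bar>\<phi> t\<bar> \<le> c"
  then have "AE t in lebesgue. ereal \<bar>\<phi> t\<bar> \<le> ereal c" by (simp add: AE_completion_iff)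
  then show "linf_norm \<phi> \<le> ereal c"
    unfolding linf_norm_def using assms by (intro esssup_I) auto
qed

text \<open>Completeness of Lebesgue measure: the preimages under \<open>f\<close> and
  \<open>g\<close> differ only inside a null set, all of whose subsets are measurable.\<close>

lemma borel_measurable_lebesgue_cong_AE:
  fixes f g :: "'a::euclidean_space \<Rightarrow> real"
  assumes "f \<in> borel_measurable lebesgue" "AE x in lborel. f x = g x"
  shows "g \<in> borel_measurable lebesgue"
proof (rule measurableI)
  fix A :: "real set" assume A: "A \<in> sets borel"
  obtain N where N: "{x. f x \<noteq> g x} \<subseteq> N" "N \<in> null_sets (lborel :: 'a measure)"
    using assms(2) unfolding eventually_ae_filter by auto
  have null: "{x. f x \<noteq> g x} \<inter> B \<in> sets lebesgue" for B
    using N by (intro sets_completionI_sub[where N'=N]) auto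
  have "g -` A = (f -` A - {x. f x \<noteq> g x}) \<union> {x. f x \<noteq> g x} \<inter> (g -` A)"
    by auto
  also have "\<dots> \<in> sets lebesgue"
    using null[of UNIV] null measurable_sets[OF assms(1) A] by (intro sets.Un sets.Diff) auto
  finally show "g -` A \<inter> space lebesgue \<in> sets lebesgue" by simp
qed simp

text \<open>A Borel version of the function is shifted instead; translation invariance keeps the
  exceptional set null.\<close>

lemma borel_measurable_lebesgue_shift:
  fixes \<phi> :: "real \<Rightarrow> real"
  assumes "\<phi> \<in> borel_measurable lebesgue"
  shows "(\<lambda>t. \<phi> (t + h)) \<in> borel_measurable lebesgue"
proof -
  obtain g where g: "g \<in> borel_measurable lborel" "AE t in lborel. \<phi> t = g t"
    using completion_ex_borel_measurable_real[OF assms] by blast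
  have "(\<lambda>t. g (t + h)) \<in> borel_measurable lebesgue"
    using g(1) by (intro measurable_completion) simp
  moreover have "AE t in lborel. g (t + h) = \<phi> (t + h)"
    using AE_lborel_shift[OF g(2)] by (simp add: eq_commute)
  ultimately show ?thesis by (rule borel_measurable_lebesgue_cong_AE)
qed

lemma diff_op_measurable:
  "\<phi> \<in> borel_measurable lebesgue \<Longrightarrow> diff_op h \<phi> \<in> borel_measurable lebesgue"
  unfolding diff_op_def[abs_def] using borel_measurable_lebesgue_shift by (intro borel_measurable_diff)

lemma linf_norm_cong_AE:
  assumes "\<phi> \<in> borel_measurable lebesgue" "AE t in lborel. \<phi> t = \<psi> t"
  shows "linf_norm \<phi> = linf_norm \<psi>"
  unfolding linf_norm_def
proof (rule esssup_AE_cong)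
  show "(\<lambda>t. ereal \<bar>\<psi> t\<bar>) \<in> borel_measurable lebesgue"
    using borel_measurable_lebesgue_cong_AE[OF assms] by simp
  show "AE t in lebesgue. ereal \<bar>\<phi> t\<bar> = ereal \<bar>\<psi> t\<bar>"
    using assms(2) unfolding AE_completion_iff by (elim eventually_mono) simp
qed (use assms(1) in simp)

lemma lip_seminorm_nonneg: "0 \<le> lip_seminorm \<alpha> \<phi>"
  unfolding lip_seminorm_def
  by (rule SUP_upper2[of 1]) (auto intro: linf_norm_nonneg)

lemma lip_seminorm_le_iff:
  assumes "\<phi> \<in> borel_measurable lebesgue"
  shows "lip_seminorm \<alpha> \<phi> \<le> ereal c \<longleftrightarrow>
    (\<forall>h>0. AE t in lborel. \<bar>\<phi> (t + h) - \<phi> t\<bar> \<le> c * h powr \<alpha>)"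
proof -
  have "ereal (h powr (- \<alpha>)) * linf_norm (diff_op h \<phi>) \<le> ereal c \<longleftrightarrow>
    (AE t in lborel. \<bar>\<phi> (t + h) - \<phi> t\<bar> \<le> c * h powr \<alpha>)" if "h > 0" for h
  proof -
    have "ereal (h powr (- \<alpha>)) * linf_norm (diff_op h \<phi>) \<le> ereal c \<longleftrightarrow>
      linf_norm (diff_op h \<phi>) \<le> ereal (c * h powr \<alpha>)"
      using that by (cases "linf_norm (diff_op h \<phi>)") (auto simp: powr_minus field_simps)
    also have "\<dots> \<longleftrightarrow> (AE t in lborel. \<bar>\<phi> (t + h) - \<phi> t\<bar> \<le> c * h powr \<alpha>)"
      by (simp add: linf_norm_le_iff diff_op_measurable assms diff_op_def)
    finally show ?thesis .
  qed
  then show ?thesis unfolding lip_seminorm_def by (auto simp: SUP_le_iff)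
qed

lemma lip_norm_nonneg: "0 \<le> lip_norm \<alpha> \<phi>"
  unfolding lip_norm_def
  by (intro real_of_ereal_pos add_nonneg_nonneg linf_norm_nonneg lip_seminorm_nonneg)

lemma in_LipD:
  assumes "in_Lip \<alpha> \<phi>"
  shows "AE t in lborel. \<bar>\<phi> t\<bar> \<le> lip_norm \<alpha> \<phi>"
    and "h > 0 \<Longrightarrow> AE t in lborel. \<bar>\<phi> (t + h) - \<phi> t\<bar> \<le> lip_norm \<alpha> \<phi> * h powr \<alpha>"
proof -
  have m: "\<phi> \<in> borel_measurable lebesgue" using assms by (simp add: in_Lip_def)
  \<comment> \<open>Membership in the class makes both summands finite, so
    \<open>real_of_ereal\<close> in \<open>lip_norm\<close> loses nothing.\<close>
  obtain a where a: "linf_norm \<phi> = ereal a"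
    using assms linf_norm_nonneg[of \<phi>] by (cases "linf_norm \<phi>") (auto simp: in_Lip_def)
  obtain b where b: "lip_seminorm \<alpha> \<phi> = ereal b"
    using assms lip_seminorm_nonneg[of \<alpha> \<phi>] by (cases "lip_seminorm \<alpha> \<phi>") (auto simp: in_Lip_def)
  have nonneg: "a \<ge> 0" "b \<ge> 0"
    using a b linf_norm_nonneg[of \<phi>] lip_seminorm_nonneg[of \<alpha> \<phi>] by auto
  have c: "lip_norm \<alpha> \<phi> = a + b" by (simp add: lip_norm_def a b)
  show "AE t in lborel. \<bar>\<phi> t\<bar> \<le> lip_norm \<alpha> \<phi>"
    using linf_norm_le_iff[OF m, of "a + b"] a nonneg c by simp
  show "AE t in lborel. \<bar>\<phi> (t + h) - \<phi> t\<bar> \<le> lip_norm \<alpha> \<phi> * h powr \<alpha>" if "h > 0"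
    using lip_seminorm_le_iff[OF m, of \<alpha> "a + b"] b nonneg c that by simp
qed

lemma in_LipI:
  assumes m: "\<phi> \<in> borel_measurable lebesgue" and a: "AE t in lborel. \<bar>\<phi> t\<bar> \<le> a"
    and b: "\<And>h. h > 0 \<Longrightarrow> AE t in lborel. \<bar>\<phi> (t + h) - \<phi> t\<bar> \<le> b * h powr \<alpha>"
  shows "in_Lip \<alpha> \<phi>" and "lip_norm \<alpha> \<phi> \<le> a + b"
proof -
  have *: "linf_norm \<phi> \<le> ereal a" "lip_seminorm \<alpha> \<phi> \<le> ereal b"
    using a b by (auto simp: linf_norm_le_iff lip_seminorm_le_iff m)
  then show "in_Lip \<alpha> \<phi>" using m
    by (auto simp: in_Lip_def intro: le_less_trans)
  show "lip_norm \<alpha> \<phi> \<le> a + b"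
    using * linf_norm_nonneg[of \<phi>] lip_seminorm_nonneg[of \<alpha> \<phi>] unfolding lip_norm_def
    by (cases "linf_norm \<phi>"; cases "lip_seminorm \<alpha> \<phi>") auto
qed

section \<open>Pointwise Hoelder bounds from essential ones\<close>

text \<open>In the hypothesis the exceptional set of \<open>t\<close> depends on \<open>h\<close>.
  Fubini exchanges \<open>t\<close> and \<open>h\<close>, and the substitution
  \<open>h = y' - y\<close> settles the pairs with \<open>y < y'\<close>. A second exchange settles
  \<open>y' < y\<close>.\<close>

lemma AE_Holder_pairs:
  fixes u :: "real \<Rightarrow> real"
  assumes [measurable]: "u \<in> borel_measurable borel"
    and H: "\<And>h. h > 0 \<Longrightarrow> AE t in lborel. \<bar>u (t + h) - u t\<bar> \<le> M * h powr \<alpha>"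
  shows "AE y in lborel. AE y' in lborel. \<bar>u y - u y'\<bar> \<le> M * \<bar>y - y'\<bar> powr \<alpha>"
proof -
  let ?R = "\<lambda>y y'. y < y' \<longrightarrow> \<bar>u y - u y'\<bar> \<le> M * \<bar>y - y'\<bar> powr \<alpha>"
  have "AE h in lborel. AE t in lborel. h > 0 \<longrightarrow> \<bar>u (t + h) - u t\<bar> \<le> M * h powr \<alpha>"
  proof (rule AE_I2)
    show "AE t in lborel. h > 0 \<longrightarrow> \<bar>u (t + h) - u t\<bar> \<le> M * h powr \<alpha>" for h
      using H[of h] by (cases "h > 0") (simp_all del: abs_le_iff)
  qed
  then have "AE t in lborel. AE h in lborel. h > 0 \<longrightarrow> \<bar>u (t + h) - u t\<bar> \<le> M * h powr \<alpha>"
    by (subst borel_prod_AE_commute) measurable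
  then have 1: "AE y in lborel. AE y' in lborel. ?R y y'"
  proof (rule eventually_mono)
    fix y assume "AE h in lborel. h > 0 \<longrightarrow> \<bar>u (y + h) - u y\<bar> \<le> M * h powr \<alpha>"
    from AE_lborel_shift[OF this, of "- y"] show "AE y' in lborel. ?R y y'"
      by (elim eventually_mono) (auto simp: abs_minus_commute)
  qed
  then have "AE y in lborel. AE y' in lborel. ?R y' y"
    by (subst borel_prod_AE_commute) measurable
  with 1 show ?thesis
  proof eventually_elim
    case (elim y)
    from eventually_conj[OF elim] show ?case
    proof (rule eventually_mono)
      show "\<bar>u y - u y'\<bar> \<le> M * \<bar>y - y'\<bar> powr \<alpha>" if "?R y y' \<and> ?R y' y" for y'
        using that abs_minus_commute[of "u y" "u y'"] abs_minus_commute[of y y']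
        by (cases y y' rule: linorder_cases) simp_all
    qed
  qed
qed

lemma AE_lborel_dense:
  fixes c :: real
  assumes "AE y in lborel. P y" "e > 0"
  obtains y where "\<bar>y - c\<bar> < e" "P y"
proof -
  have "\<exists>y. \<bar>y - c\<bar> < e \<and> P y"
  proof (rule ccontr)
    assume "\<not> ?thesis"
    with assms(1) have "AE y in lborel. y \<notin> {c - e <..< c + e}"
      by (auto elim!: eventually_mono simp: abs_less_iff)
    then have "emeasure lborel {c - e <..< c + e} = 0"
      by (subst (asm) AE_iff_measurable[OF _ refl]) (auto simp: greaterThanLessThan_def greaterThan_def lessThan_def Int_def)
    with assms(2) show False by simp
  qed
  then show ?thesis using that by blast
qed

text \<open>A point \<open>t\<close> that is good for both \<open>y\<close> and \<open>y'\<close> is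
  sent to \<open>y'\<close>. The triangle inequality through \<open>t\<close> has a second term that
  vanishes in the limit, so the constant stays \<open>M\<close>.\<close>

lemma Holder_of_AE:
  fixes u :: "real \<Rightarrow> real"
  assumes "\<alpha> > 0" and y: "AE t in lborel. \<bar>u y - u t\<bar> \<le> M * \<bar>y - t\<bar> powr \<alpha>"
    and y': "AE t in lborel. \<bar>u y' - u t\<bar> \<le> M * \<bar>y' - t\<bar> powr \<alpha>"
  shows "\<bar>u y - u y'\<bar> \<le> M * \<bar>y - y'\<bar> powr \<alpha>"
proof -
  have "\<exists>t. \<bar>t - y'\<bar> < 1 / Suc n \<and> \<bar>u y - u t\<bar> \<le> M * \<bar>y - t\<bar> powr \<alpha> \<and>
      \<bar>u y' - u t\<bar> \<le> M * \<bar>y' - t\<bar> powr \<alpha>" for n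
    using AE_lborel_dense[OF AE_conjI[OF y y'], of "1 / Suc n"] by (metis divide_pos_pos of_nat_0_less_iff zero_less_Suc zero_less_one)
  then obtain t where t: "\<And>n. \<bar>t n - y'\<bar> < 1 / Suc n" "\<And>n. \<bar>u y - u (t n)\<bar> \<le> M * \<bar>y - t n\<bar> powr \<alpha>"
      "\<And>n. \<bar>u y' - u (t n)\<bar> \<le> M * \<bar>y' - t n\<bar> powr \<alpha>"
    by metis
  have "(\<lambda>n. t n - y') \<longlonglongrightarrow> 0"
    by (rule Lim_null_comparison[OF _ LIMSEQ_inverse_real_of_nat])
      (use t(1) in \<open>auto intro!: always_eventually simp: inverse_eq_divide intro: less_imp_le\<close>)
  then have lim: "t \<longlonglongrightarrow> y'" by (simp add: LIM_zero_iff)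
  have "(\<lambda>n. M * \<bar>y - t n\<bar> powr \<alpha> + M * \<bar>y' - t n\<bar> powr \<alpha>) \<longlonglongrightarrow>
      M * \<bar>y - y'\<bar> powr \<alpha> + M * \<bar>y' - y'\<bar> powr \<alpha>"
    using \<open>\<alpha> > 0\<close> by (intro tendsto_intros tendsto_powr' lim) auto
  moreover have "\<bar>u y - u y'\<bar> \<le> M * \<bar>y - t n\<bar> powr \<alpha> + M * \<bar>y' - t n\<bar> powr \<alpha>" for n
    using t(2,3)[of n] by linarith
  ultimately show ?thesis
    using LIMSEQ_le_const by fastforce
qed

section \<open>Distribution functions and rearrangements\<close>

lemma sets_superlevel_abs:
  fixes g :: "real \<Rightarrow> real"
  assumes "g \<in> borel_measurable lebesgue"
  shows "{t. c < \<bar>g t\<bar>} \<in> sets lebesgue"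
proof -
  have "{t \<in> space lebesgue. c < \<bar>g t\<bar>} \<in> sets lebesgue"
    using assms by measurable
  then show ?thesis by simp
qed

text \<open>Otherwise almost all of an interval of length \<open>2 * r\<close> would lie in a
  superlevel set of measure at most \<open>s < 2 * r\<close>. The property \<open>P\<close> comes
  for free because it fails only on a null set.\<close>

lemma AE_interval_select:
  assumes \<psi>: "\<psi> \<in> borel_measurable lebesgue" "distrib_fun \<psi> a \<le> ennreal s"
    and "s < 2 * r" "r > 0" and P: "AE y in lborel. P y"
  obtains y where "\<bar>y - c\<bar> \<le> r" "P y" "\<bar>\<psi> y\<bar> \<le> a"
proof -
  have "\<exists>y. \<bar>y - c\<bar> \<le> r \<and> P y \<and> \<bar>\<psi> y\<bar> \<le> a"
  proof (rule ccontr)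
    assume *: "\<not> ?thesis"
    have "ennreal (2 * r) = emeasure lebesgue {c - r .. c + r}"
      using \<open>r > 0\<close> by simp
    also have "\<dots> \<le> emeasure lebesgue {t. a < \<bar>\<psi> t\<bar>}"
    proof (rule emeasure_mono_AE)
      show "AE x in lebesgue. x \<in> {c - r..c + r} \<longrightarrow> x \<in> {t. a < \<bar>\<psi> t\<bar>}"
        using P unfolding AE_completion_iff
        by eventually_elim (use * in \<open>auto simp: abs_le_iff not_le\<close>)
    qed (rule sets_superlevel_abs[OF \<psi>(1)])
    also have "\<dots> \<le> ennreal s" using \<psi>(2) by (simp add: distrib_fun_def)
    finally show False using assms(3,4) by (simp add: ennreal_le_iff2)
  qed
  then show ?thesis using that by blast
qed

lemma distrib_fun_antimono:
  assumes "g \<in> borel_measurable lebesgue" "s \<le> s'"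
  shows "distrib_fun g s' \<le> distrib_fun g s"
  unfolding distrib_fun_def using assms by (intro emeasure_mono sets_superlevel_abs) auto

lemma rearr_le:
  assumes "0 \<le> r" "distrib_fun g r \<le> ennreal t"
  shows "rearr g t \<le> r"
  unfolding rearr_def using assms by (intro cInf_lower bdd_belowI[where m=0]) auto

text \<open>Continuity from above: the superlevel sets have finite measure and decrease to the empty
  set. Hence the infimum in \<open>rearr\<close> runs over a nonempty set when
  \<open>t > 0\<close>.\<close>

lemma ex_distrib_fun_le:
  assumes "in_S0 g" "t > 0"
  shows "\<exists>s\<ge>0. distrib_fun g s \<le> ennreal t"
proof -
  have m: "{t. c < \<bar>g t\<bar>} \<in> sets lebesgue" for c
    using assms(1) by (intro sets_superlevel_abs) (simp add: in_S0_def)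
  have "(\<lambda>n. emeasure lebesgue {t. real (Suc n) < \<bar>g t\<bar>}) \<longlonglongrightarrow>
      emeasure lebesgue (\<Inter>n. {t. real (Suc n) < \<bar>g t\<bar>})"
  proof (rule Lim_emeasure_decseq)
    show "emeasure lebesgue {t. real (Suc n) < \<bar>g t\<bar>} \<noteq> \<infinity>" for n
      using assms(1) unfolding in_S0_def distrib_fun_def by (simp add: less_top)
  qed (use m in \<open>auto simp: decseq_def\<close>)
  moreover have "(\<Inter>n. {t. real (Suc n) < \<bar>g t\<bar>}) = {}"
    by auto (metis less_le_not_le lessI less_imp_le of_nat_less_iff order_trans real_arch_simple of_nat_Suc)
  ultimately have "(\<lambda>n. distrib_fun g (real (Suc n))) \<longlonglongrightarrow> 0"
    by (simp add: distrib_fun_def)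
  then have "eventually (\<lambda>n. distrib_fun g (real (Suc n)) < ennreal t) sequentially"
    using assms(2) by (intro order_tendstoD) auto
  then obtain n where "distrib_fun g (real (Suc n)) < ennreal t"
    by (auto simp: eventually_sequentially)
  then show ?thesis by (intro exI[of _ "real (Suc n)"]) auto
qed

lemma rearr_nonneg:
  assumes "in_S0 g" "t > 0"
  shows "0 \<le> rearr g t"
  unfolding rearr_def using ex_distrib_fun_le[OF assms] by (intro cInf_greatest) auto

text \<open>The infimum is attained, by continuity from below: the superlevel sets at
  \<open>rearr g t + 1 / Suc n\<close> increase to the one at \<open>rearr g t\<close>.\<close>

lemma distrib_fun_rearr:
  assumes "in_S0 g" "t > 0"
  shows "distrib_fun g (rearr g t) \<le> ennreal t"
proof -
  have gm: "g \<in> borel_measurable lebesgue" using assms by (simp add: in_S0_def)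
  let ?A = "\<lambda>n. {x. rearr g t + 1 / Suc n < \<bar>g x\<bar>}"
  have *: "distrib_fun g (rearr g t + 1 / Suc n) \<le> ennreal t" for n
  proof -
    have "rearr g t < rearr g t + 1 / Suc n" by simp
    then obtain s where "0 \<le> s" "distrib_fun g s \<le> ennreal t" "s < rearr g t + 1 / Suc n"
      unfolding rearr_def using ex_distrib_fun_le[OF assms] cInf_lessD
      by (smt (verit, ccfv_threshold) Collect_empty_eq mem_Collect_eq)
    then show ?thesis using distrib_fun_antimono[OF gm, of s "rearr g t + 1 / Suc n"] by simp
  qed
  have "(\<lambda>n. emeasure lebesgue (?A n)) \<longlonglongrightarrow> emeasure lebesgue (\<Union>n. ?A n)"
  proof (rule Lim_emeasure_incseq)
    show "incseq ?A"
    proof (rule incseq_SucI, rule subsetI)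
      fix n x assume "x \<in> ?A n"
      moreover have "1 / real (Suc (Suc n)) \<le> 1 / Suc n" by (simp add: field_simps)
      ultimately show "x \<in> ?A (Suc n)" unfolding mem_Collect_eq by linarith
    qed
  qed (use sets_superlevel_abs[OF gm] in auto)
  moreover have "(\<Union>n. ?A n) = {x. rearr g t < \<bar>g x\<bar>}"
  proof safe
    fix x assume "rearr g t < \<bar>g x\<bar>"
    then obtain n where "1 / Suc n < \<bar>g x\<bar> - rearr g t"
      using nat_approx_posE[of "\<bar>g x\<bar> - rearr g t"] by auto
    then show "x \<in> (\<Union>n. ?A n)" by (auto simp: algebra_simps)
  next
    fix x n assume "rearr g t + 1 / real (Suc n) < \<bar>g x\<bar>"
    moreover have "0 < 1 / real (Suc n)" by simp
    ultimately show "rearr g t < \<bar>g x\<bar>" by linarith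
  qed
  ultimately show ?thesis
    using * unfolding distrib_fun_def by (intro LIMSEQ_le_const2) auto
qed

lemma rearr_antimono:
  assumes "in_S0 g" "0 < s" "s \<le> t"
  shows "rearr g t \<le> rearr g s"
  using distrib_fun_rearr[OF assms(1,2)] assms
  by (intro rearr_le rearr_nonneg) (auto intro: order_trans ennreal_leI)

text \<open>Monotonicity gives measurability, but it is known only for positive arguments; the
  indicator discards the rest.\<close>

lemma measurable_rearr:
  assumes "in_S0 g"
  shows "(\<lambda>t. indicator {0<..} t * rearr g t) \<in> borel_measurable borel"
proof -
  have "mono_on {0<..} (\<lambda>t. - rearr g t)"
    using rearr_antimono[OF assms] by (auto simp: mono_on_def)
  from borel_measurable_mono_on_fnc[OF this]
  have "rearr g \<in> borel_measurable (restrict_space borel {0<..})"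
    using borel_measurable_uminus_eq by blast
  then show ?thesis
    by (subst (asm) borel_measurable_restrict_space_iff) (auto simp: mult.commute)
qed

section \<open>Chains of points at dyadic scales\<close>

text \<open>
  The relation \<open>E\<close> selects a conull set of points at which the essential-supremum bounds hold
  pointwise, so that a chain can be followed from point to point without exceptional sets.
\<close>

locale holder_grid =
  fixes f :: "real \<Rightarrow> real \<Rightarrow> real" and \<phi> \<psi> :: "real \<Rightarrow> real"
    and E :: "real \<Rightarrow> real \<Rightarrow> bool" and \<alpha> :: real
  assumes \<alpha>: "0 < \<alpha>" "\<alpha> \<le> 1"
    and S0: "in_S0 \<phi>" "in_S0 \<psi>"
    and AE_E: "AE x in lborel. AE y in lborel. E x y" "AE y in lborel. AE x in lborel. E x y"
    and bound: "E x y \<Longrightarrow> \<bar>f x y\<bar> \<le> \<phi> x"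
    and holder_x: "E x y \<Longrightarrow> E x y' \<Longrightarrow> \<bar>f x y - f x y'\<bar> \<le> \<phi> x * \<bar>y - y'\<bar> powr \<alpha>"
    and holder_y: "E x y \<Longrightarrow> E x' y \<Longrightarrow> \<bar>f x y - f x' y\<bar> \<le> \<psi> y * \<bar>x - x'\<bar> powr \<alpha>"
begin

definition \<Phi> :: "real \<Rightarrow> real" where
  "\<Phi> t = rearr \<phi> t + rearr \<psi> t"

lemma \<Phi>_nonneg: "t > 0 \<Longrightarrow> 0 \<le> \<Phi> t"
  unfolding \<Phi>_def by (intro add_nonneg_nonneg rearr_nonneg S0)

lemma rearr_le_\<Phi>: "t > 0 \<Longrightarrow> rearr \<phi> t \<le> \<Phi> t"
  unfolding \<Phi>_def using rearr_nonneg[OF S0(2)] by simp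

text \<open>Since \<alpha> is at most 1, the factor \<open>c powr \<alpha>\<close> can be replaced
  by \<open>c\<close>, which keeps the later constants independent of \<alpha>.\<close>

lemma powr_scale:
  assumes "c \<ge> 1" "t \<ge> 0"
  shows "(c * t) powr \<alpha> \<le> c * t powr \<alpha>"
proof -
  have "c powr \<alpha> \<le> c powr 1" using assms \<alpha> by (intro powr_mono) auto
  then show ?thesis using assms by (simp add: powr_mult mult_right_mono)
qed

text \<open>Two points on the same line \<open>x\<close> are moved to one common new line
  \<open>x1\<close>, so that their difference can again be followed. The line \<open>x1\<close>
  satisfies the hypothesis on \<open>x\<close> with \<open>2 * s\<close> in place of
  \<open>s\<close>, which allows iteration.\<close>

lemma grid_step:
  assumes s: "s > 0" and x: "AE y in lborel. E x y" "\<bar>\<phi> x\<bar> \<le> rearr \<phi> s"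
    and y: "E x y" "E x y'"
  obtains x1 y1 y1' where
    "AE y in lborel. E x1 y" "\<bar>\<phi> x1\<bar> \<le> rearr \<phi> (2 * s)" "E x1 y1" "E x1 y1'"
    "\<bar>y1 - y1'\<bar> \<le> \<bar>y - y'\<bar> + 2 * s"
    "\<bar>f x y - f x1 y1\<bar> \<le> 2 * s powr \<alpha> * \<Phi> s" "\<bar>f x y' - f x1 y1'\<bar> \<le> 2 * s powr \<alpha> * \<Phi> s"
proof -
  have \<psi>m: "\<psi> \<in> borel_measurable lebesgue" and \<phi>m: "\<phi> \<in> borel_measurable lebesgue"
    using S0 by (auto simp: in_S0_def)
  \<comment> \<open>An interval of radius \<open>s\<close> has length \<open>2 * s\<close>, more
    than the measure bound \<open>s\<close>. The same margin holds below for radius and measure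
    bound \<open>2 * s\<close>.\<close>
  note sel = AE_interval_select[OF \<psi>m distrib_fun_rearr[OF S0(2) s], of s]
  obtain y1 where y1: "\<bar>y1 - y\<bar> \<le> s" "E x y1" "AE x in lborel. E x y1" "\<bar>\<psi> y1\<bar> \<le> rearr \<psi> s"
    using sel[OF _ s AE_conjI[OF x(1) AE_E(2)], of y] s by auto
  obtain y1' where y1': "\<bar>y1' - y'\<bar> \<le> s" "E x y1'" "AE x in lborel. E x y1'" "\<bar>\<psi> y1'\<bar> \<le> rearr \<psi> s"
    using sel[OF _ s AE_conjI[OF x(1) AE_E(2)], of y'] s by auto
  have "2 * s > 0" using s by simp
  from AE_interval_select[OF \<phi>m distrib_fun_rearr[OF S0(1) this] _ this
      AE_conjI[OF AE_E(1) AE_conjI[OF y1(3) y1'(3)]], of x] s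
  obtain x1 where x1: "\<bar>x1 - x\<bar> \<le> 2 * s" "AE y in lborel. E x1 y" "E x1 y1" "E x1 y1'"
    "\<bar>\<phi> x1\<bar> \<le> rearr \<phi> (2 * s)" by auto
  have cost: "\<bar>f x z - f x1 z1\<bar> \<le> 2 * s powr \<alpha> * \<Phi> s"
    if "E x z" "E x z1" "E x1 z1" "\<bar>z1 - z\<bar> \<le> s" "\<bar>\<psi> z1\<bar> \<le> rearr \<psi> s" for z z1
  proof -
    have "\<bar>f x z - f x z1\<bar> \<le> \<phi> x * \<bar>z - z1\<bar> powr \<alpha>" by (rule holder_x[OF that(1,2)])
    also have "\<dots> \<le> rearr \<phi> s * s powr \<alpha>"
      using x(2) that(4) \<alpha> rearr_nonneg[OF S0(1) s]
      by (intro mult_mono powr_mono2) auto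
    finally have 1: "\<bar>f x z - f x z1\<bar> \<le> rearr \<phi> s * s powr \<alpha>" .
    have "\<bar>f x z1 - f x1 z1\<bar> \<le> \<psi> z1 * \<bar>x - x1\<bar> powr \<alpha>" by (rule holder_y[OF that(2,3)])
    also have "\<dots> \<le> rearr \<psi> s * (2 * s) powr \<alpha>"
      using that(5) x1(1) \<alpha> rearr_nonneg[OF S0(2) s]
      by (intro mult_mono powr_mono2) auto
    also have "\<dots> \<le> rearr \<psi> s * (2 * s powr \<alpha>)"
      using powr_scale[of 2 s] rearr_nonneg[OF S0(2) s] s by (intro mult_left_mono) auto
    finally have 2: "\<bar>f x z1 - f x1 z1\<bar> \<le> rearr \<psi> s * (2 * s powr \<alpha>)" .
    \<comment> \<open>The \<phi> term is doubled so that both rearrangements carry the same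
      coefficient and combine into \<open>\<Phi> s\<close>.\<close>
    have "0 \<le> rearr \<phi> s * s powr \<alpha>" using rearr_nonneg[OF S0(1) s] by simp
    with 1 2 have "\<bar>f x z - f x1 z1\<bar> \<le> 2 * (rearr \<phi> s * s powr \<alpha>) + rearr \<psi> s * (2 * s powr \<alpha>)"
      by linarith
    then show ?thesis by (simp add: \<Phi>_def algebra_simps)
  qed
  show ?thesis
  proof (rule that)
    show "\<bar>y1 - y1'\<bar> \<le> \<bar>y - y'\<bar> + 2 * s" using y1(1) y1'(1) by linarith
  qed (use x1 y1 y1' y cost in auto)
qed

text \<open>After \<open>n\<close> steps the gap between the two points has grown by at most 2 (s +
  2 s + ... + 2^(n-1) s), which is \<open>2 * (2 ^ n - 1) * s\<close>; the pair is then compared on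
  its final line. The coefficient 4 is a cost of 2 for each of the two points. The bound for a
  single point keeps the same sum, so that both go through one induction.\<close>

lemma grid_chain:
  assumes "s > 0" "AE y in lborel. E x y" "\<bar>\<phi> x\<bar> \<le> rearr \<phi> s" "E x y" "E x y'"
  shows "\<bar>f x y - f x y'\<bar> \<le> rearr \<phi> (2 ^ n * s) * (\<bar>y - y'\<bar> + 2 * (2 ^ n - 1) * s) powr \<alpha> +
      (\<Sum>k<n. 4 * (2 ^ k * s) powr \<alpha> * \<Phi> (2 ^ k * s))"
    and "\<bar>f x y\<bar> \<le> rearr \<phi> (2 ^ n * s) + (\<Sum>k<n. 4 * (2 ^ k * s) powr \<alpha> * \<Phi> (2 ^ k * s))"
proof -
  have "\<bar>f x y - f x y'\<bar> \<le> rearr \<phi> (2 ^ n * s) * (\<bar>y - y'\<bar> + 2 * (2 ^ n - 1) * s) powr \<alpha> +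
      (\<Sum>k<n. 4 * (2 ^ k * s) powr \<alpha> * \<Phi> (2 ^ k * s)) \<and>
    \<bar>f x y\<bar> \<le> rearr \<phi> (2 ^ n * s) + (\<Sum>k<n. 4 * (2 ^ k * s) powr \<alpha> * \<Phi> (2 ^ k * s))"
    using assms
  proof (induction n arbitrary: s x y y')
    case 0
    have "\<phi> x * \<bar>y - y'\<bar> powr \<alpha> \<le> rearr \<phi> s * \<bar>y - y'\<bar> powr \<alpha>"
      using 0(3) by (intro mult_right_mono) auto
    with 0 holder_x[of x y y'] bound[of x y] show ?case by simp
  next
    case (Suc n)
    from grid_step[OF Suc.prems] obtain x1 y1 y1' where *:
      "AE y in lborel. E x1 y" "\<bar>\<phi> x1\<bar> \<le> rearr \<phi> (2 * s)" "E x1 y1" "E x1 y1'"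
      "\<bar>y1 - y1'\<bar> \<le> \<bar>y - y'\<bar> + 2 * s"
      "\<bar>f x y - f x1 y1\<bar> \<le> 2 * s powr \<alpha> * \<Phi> s" "\<bar>f x y' - f x1 y1'\<bar> \<le> 2 * s powr \<alpha> * \<Phi> s"
      by metis
    let ?S = "\<Sum>k<n. 4 * (2 ^ k * (2 * s)) powr \<alpha> * \<Phi> (2 ^ k * (2 * s))"
    \<comment> \<open>The first step is the term \<open>k = 0\<close>; what remains is the sum of a
      chain that starts at scale \<open>2 * s\<close>.\<close>
    have S: "(\<Sum>k<Suc n. 4 * (2 ^ k * s) powr \<alpha> * \<Phi> (2 ^ k * s)) = 4 * s powr \<alpha> * \<Phi> s + ?S"
      by (subst sum.lessThan_Suc_shift) (simp add: mult_ac)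
    have s2: "2 * s > 0" using Suc.prems(1) by simp
    have pos: "0 \<le> s powr \<alpha> * \<Phi> s" using \<Phi>_nonneg Suc.prems(1) by simp
    have eq: "rearr \<phi> (2 ^ n * (2 * s)) = rearr \<phi> (2 ^ Suc n * s)" by (simp add: mult_ac)
    note IH = Suc.IH[OF s2 *(1-4)]
    \<comment> \<open>The gap bound closes up because 2 s + 2 (2^n - 1) (2 s) = 2 (2^(n+1) - 1)
      s.\<close>
    have "rearr \<phi> (2 ^ n * (2 * s)) * (\<bar>y1 - y1'\<bar> + 2 * (2 ^ n - 1) * (2 * s)) powr \<alpha> \<le>
        rearr \<phi> (2 ^ n * (2 * s)) * (\<bar>y - y'\<bar> + 2 * (2 ^ Suc n - 1) * s) powr \<alpha>"
      using *(5) \<alpha> Suc.prems(1)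
      by (intro mult_left_mono powr_mono2 rearr_nonneg S0 add_nonneg_nonneg mult_nonneg_nonneg)
        (auto simp: algebra_simps)
    with IH *(6,7) have 1: "\<bar>f x y - f x y'\<bar> \<le> rearr \<phi> (2 ^ Suc n * s) *
        (\<bar>y - y'\<bar> + 2 * (2 ^ Suc n - 1) * s) powr \<alpha> + (4 * s powr \<alpha> * \<Phi> s + ?S)"
      unfolding eq by linarith
    from IH *(6) pos have 2: "\<bar>f x y\<bar> \<le> rearr \<phi> (2 ^ Suc n * s) + (4 * s powr \<alpha> * \<Phi> s + ?S)"
      unfolding eq by linarith
    from 1 2 show ?case unfolding S by blast
  qed
  then show "\<bar>f x y - f x y'\<bar> \<le> rearr \<phi> (2 ^ n * s) * (\<bar>y - y'\<bar> + 2 * (2 ^ n - 1) * s) powr \<alpha> +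
      (\<Sum>k<n. 4 * (2 ^ k * s) powr \<alpha> * \<Phi> (2 ^ k * s))"
    and "\<bar>f x y\<bar> \<le> rearr \<phi> (2 ^ n * s) + (\<Sum>k<n. 4 * (2 ^ k * s) powr \<alpha> * \<Phi> (2 ^ k * s))"
    by auto
qed

section \<open>Lipschitz norms of sections against the dyadic sum\<close>

text \<open>This is the sum A(s) of the overview, with values in \<open>ennreal\<close> so that it
  may diverge.\<close>

definition dyadic_sum :: "real \<Rightarrow> real \<Rightarrow> ennreal" where
  "dyadic_sum d s = (\<Sum>k. ennreal ((2 ^ k * s) powr d * \<Phi> (2 ^ k * s)))"

lemma partial_dyadic_sum_le:
  assumes "s > 0" "0 \<le> r" "dyadic_sum d s \<le> ennreal r"
  shows "(\<Sum>k<n. (2 ^ k * s) powr d * \<Phi> (2 ^ k * s)) \<le> r"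
proof -
  have nn: "0 \<le> (2 ^ k * s) powr d * \<Phi> (2 ^ k * s)" for k
    using assms(1) by (intro mult_nonneg_nonneg \<Phi>_nonneg) auto
  have "ennreal (\<Sum>k<n. (2 ^ k * s) powr d * \<Phi> (2 ^ k * s)) =
      (\<Sum>k<n. ennreal ((2 ^ k * s) powr d * \<Phi> (2 ^ k * s)))"
    using nn by (intro sum_ennreal[symmetric]) auto
  also have "\<dots> \<le> dyadic_sum d s"
    unfolding dyadic_sum_def by (intro sum_le_suminf) auto
  also note assms(3)
  finally show ?thesis using assms(2) by simp
qed

text \<open>The chain stops at the first scale 2^n s that is at least 1. At earlier scales t < 1, so
  t^\<alpha> <= t^d. At the last one t^d >= 1, which absorbs the terminal value of the
  rearrangement.\<close>

lemma section_sup_le: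
  assumes s: "s > 0" and x: "AE y in lborel. E x y" "\<bar>\<phi> x\<bar> \<le> rearr \<phi> s" "E x y"
    and d: "0 < d" "d < \<alpha>" and r: "0 \<le> r" "dyadic_sum d s \<le> ennreal r"
  shows "\<bar>f x y\<bar> \<le> 4 * r"
proof -
  define n where "n = (LEAST n. 1 \<le> 2 ^ n * s)"
  have "\<exists>n. 1 \<le> 2 ^ n * s"
  proof -
    obtain n where "1 / s < 2 ^ n" using real_arch_pow[of 2 "1 / s"] by auto
    then show ?thesis using s by (auto simp: field_simps intro!: exI[of _ n])
  qed
  then have n: "1 \<le> 2 ^ n * s" unfolding n_def by (rule LeastI_ex)
  have k: "2 ^ k * s < 1" if "k < n" for k
    using not_less_Least[of k "\<lambda>n. 1 \<le> 2 ^ n * s"] that unfolding n_def by auto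
  have pos: "0 < 2 ^ k * s" for k :: nat using s by simp
  have "rearr \<phi> (2 ^ n * s) \<le> 1 * \<Phi> (2 ^ n * s)" using rearr_le_\<Phi>[OF pos] by simp
  also have "\<dots> \<le> (2 ^ n * s) powr d * \<Phi> (2 ^ n * s)"
    using n d by (intro mult_right_mono \<Phi>_nonneg pos ge_one_powr_ge_zero) auto
  finally have 1: "rearr \<phi> (2 ^ n * s) \<le> (2 ^ n * s) powr d * \<Phi> (2 ^ n * s)" .
  have 2: "(\<Sum>k<n. 4 * (2 ^ k * s) powr \<alpha> * \<Phi> (2 ^ k * s)) \<le>
      (\<Sum>k<n. 4 * (2 ^ k * s) powr d * \<Phi> (2 ^ k * s))"
    using k d pos[THEN less_imp_le]
    by (intro sum_mono mult_right_mono mult_left_mono \<Phi>_nonneg pos powr_mono') (auto intro: less_imp_le)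
  have "(\<Sum>k<Suc n. (2 ^ k * s) powr d * \<Phi> (2 ^ k * s)) \<le> r"
    by (rule partial_dyadic_sum_le[OF s r])
  moreover have "(\<Sum>k<n. 4 * (2 ^ k * s) powr d * \<Phi> (2 ^ k * s)) =
      4 * (\<Sum>k<n. (2 ^ k * s) powr d * \<Phi> (2 ^ k * s))"
    by (simp add: sum_distrib_left mult_ac)
  moreover have "0 \<le> (2 ^ n * s) powr d * \<Phi> (2 ^ n * s)"
    by (intro mult_nonneg_nonneg \<Phi>_nonneg pos) auto
  ultimately show ?thesis
    using grid_chain(2)[OF s x x(3), of n] 1 2 by simp
qed

text \<open>If \<open>h < s\<close>, the Hoelder bound on the section itself suffices, as h^\<alpha>
  <= s^d h^(\<alpha>-d). Otherwise the chain runs up to scale about \<open>h\<close>, and every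
  scale t <= h satisfies t^\<alpha> <= t^d h^(\<alpha>-d).\<close>

lemma section_diff_le:
  assumes s: "s > 0" and x: "AE y in lborel. E x y" "\<bar>\<phi> x\<bar> \<le> rearr \<phi> s" "E x y" "E x (y + h)"
    and d: "0 < d" "d < \<alpha>" and r: "0 \<le> r" "dyadic_sum d s \<le> ennreal r" and h: "h > 0"
  shows "\<bar>f x (y + h) - f x y\<bar> \<le> 6 * r * h powr (\<alpha> - d)"
proof (cases "h < s")
  case True
  have "(\<Sum>k<1. (2 ^ k * s) powr d * \<Phi> (2 ^ k * s)) \<le> r"
    by (rule partial_dyadic_sum_le[OF s r])
  then have r': "s powr d * \<Phi> s \<le> r" by simp
  have "\<bar>f x (y + h) - f x y\<bar> \<le> \<phi> x * h powr \<alpha>"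
    using holder_x[OF x(4,3)] h by simp
  also have "\<dots> \<le> \<Phi> s * h powr \<alpha>"
    using x(2) rearr_le_\<Phi>[OF s] by (intro mult_right_mono) auto
  also have "\<dots> = h powr d * \<Phi> s * h powr (\<alpha> - d)"
    by (simp flip: powr_add add: mult_ac)
  also have "\<dots> \<le> s powr d * \<Phi> s * h powr (\<alpha> - d)"
    using True h d by (intro mult_right_mono powr_mono2 \<Phi>_nonneg s) auto
  also have "\<dots> \<le> r * h powr (\<alpha> - d)"
    using r' by (intro mult_right_mono) auto
  also have "\<dots> \<le> 6 * r * h powr (\<alpha> - d)"
    using r by (intro mult_right_mono) auto
  finally show ?thesis .
next
  case False
  \<comment> \<open>The exponent \<open>Suc n\<close> makes 2^n s the last dyadic scale not
    exceeding \<open>h\<close>, including \<open>n = 0\<close> when s <= h < 2 s.\<close>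
  define n where "n = (LEAST n. h < 2 ^ Suc n * s)"
  have "\<exists>n. h < 2 ^ Suc n * s"
  proof -
    obtain n where "h / s < 2 ^ n" using real_arch_pow[of 2 "h / s"] by auto
    then have "h < 2 ^ n * s" using s by (simp add: field_simps)
    moreover have "2 ^ n * s \<le> 2 ^ Suc n * s" using s by simp
    ultimately show ?thesis by (intro exI[of _ n]) linarith
  qed
  then have n: "h < 2 ^ Suc n * s" unfolding n_def by (rule LeastI_ex)
  have n': "2 ^ n * s \<le> h"
  proof (cases n)
    case (Suc m)
    then show ?thesis using not_less_Least[of m "\<lambda>n. h < 2 ^ Suc n * s"] unfolding n_def by auto
  qed (use False in simp)
  have pos: "0 < 2 ^ k * s" for k :: nat using s by simp
  have k: "(2 ^ k * s) powr \<alpha> \<le> (2 ^ k * s) powr d * h powr (\<alpha> - d)" if "k \<le> n" for k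
  proof -
    have "2 ^ k * s \<le> 2 ^ n * s" using that s by (intro mult_right_mono power_increasing) auto
    then have "(2 ^ k * s) powr (\<alpha> - d) \<le> h powr (\<alpha> - d)"
      using n' pos[of k] d by (intro powr_mono2) auto
    then have "(2 ^ k * s) powr d * (2 ^ k * s) powr (\<alpha> - d) \<le> (2 ^ k * s) powr d * h powr (\<alpha> - d)"
      by (intro mult_left_mono) auto
    then show ?thesis by (simp flip: powr_add)
  qed
  \<comment> \<open>The final gap is less than 2 * 2^n s + 2 * 2^n s. The larger factor 6 then
    serves as the common coefficient of all terms.\<close>
  have "rearr \<phi> (2 ^ n * s) * (\<bar>y + h - y\<bar> + 2 * (2 ^ n - 1) * s) powr \<alpha> \<le>
      \<Phi> (2 ^ n * s) * (6 * (2 ^ n * s)) powr \<alpha>"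
    using n s h \<alpha> by (intro mult_mono rearr_le_\<Phi> \<Phi>_nonneg powr_mono2 add_nonneg_nonneg mult_nonneg_nonneg)
      (auto simp: algebra_simps)
  also have "\<dots> \<le> \<Phi> (2 ^ n * s) * (6 * (2 ^ n * s) powr \<alpha>)"
    using pos[of n] by (intro mult_left_mono powr_scale \<Phi>_nonneg) auto
  finally have 1: "rearr \<phi> (2 ^ n * s) * (\<bar>y + h - y\<bar> + 2 * (2 ^ n - 1) * s) powr \<alpha> \<le>
      6 * ((2 ^ n * s) powr \<alpha> * \<Phi> (2 ^ n * s))" by (simp add: mult_ac)
  have 2: "(\<Sum>k<n. 4 * (2 ^ k * s) powr \<alpha> * \<Phi> (2 ^ k * s)) \<le>
      (\<Sum>k<n. 6 * ((2 ^ k * s) powr \<alpha> * \<Phi> (2 ^ k * s)))"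
    using \<Phi>_nonneg[OF pos] by (intro sum_mono) (simp add: mult_right_mono)
  have "\<bar>f x (y + h) - f x y\<bar> \<le> (\<Sum>k<Suc n. 6 * ((2 ^ k * s) powr \<alpha> * \<Phi> (2 ^ k * s)))"
    using grid_chain(1)[OF s x(1,2,4,3), of n] 1 2 by simp
  also have "\<dots> \<le> (\<Sum>k<Suc n. 6 * ((2 ^ k * s) powr d * h powr (\<alpha> - d) * \<Phi> (2 ^ k * s)))"
    using k by (intro sum_mono mult_left_mono mult_right_mono \<Phi>_nonneg pos) auto
  also have "\<dots> = 6 * h powr (\<alpha> - d) * (\<Sum>k<Suc n. (2 ^ k * s) powr d * \<Phi> (2 ^ k * s))"
    unfolding sum_distrib_left by (intro sum.cong) auto
  also have "\<dots> \<le> 6 * h powr (\<alpha> - d) * r"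
    by (intro mult_left_mono partial_dyadic_sum_le[OF s r]) auto
  finally show ?thesis by (simp add: mult_ac)
qed

lemma lip_norm_section_le:
  assumes s: "s > 0" and x: "AE y in lborel. E x y" "\<bar>\<phi> x\<bar> \<le> rearr \<phi> s"
    and m: "f x \<in> borel_measurable lebesgue"
    and d: "0 < d" "d < \<alpha>" and r: "0 \<le> r" "dyadic_sum d s \<le> ennreal r"
  shows "lip_norm (\<alpha> - d) (f x) \<le> 10 * r"
proof -
  have "AE y in lborel. \<bar>f x y\<bar> \<le> 4 * r"
    using x(1) by eventually_elim (rule section_sup_le[OF s x _ d r])
  moreover have "AE y in lborel. \<bar>f x (y + h) - f x y\<bar> \<le> 6 * r * h powr (\<alpha> - d)" if "h > 0" for h
    using x(1) AE_lborel_shift[OF x(1), of h]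
    by eventually_elim (rule section_diff_le[OF s x _ _ d r that])
  ultimately have "lip_norm (\<alpha> - d) (f x) \<le> 4 * r + 6 * r"
    by (intro in_LipI(2) m)
  then show ?thesis by simp
qed

text \<open>Membership is proved without finiteness of the dyadic sum. For \<open>h \<le> 1\<close>
  the exponent \<alpha> is stronger than \<alpha> - d, and for larger \<open>h\<close> twice the
  supremum bound suffices.\<close>

lemma in_Lip_section:
  assumes x: "AE y in lborel. E x y" and m: "f x \<in> borel_measurable lebesgue"
    and d: "0 < d" "d < \<alpha>"
  shows "in_Lip (\<alpha> - d) (f x)"
proof (rule in_LipI(1)[OF m])
  show "AE y in lborel. \<bar>f x y\<bar> \<le> \<phi> x"
    using x by eventually_elim (rule bound)
  fix h :: real assume h: "h > 0"
  show "AE y in lborel. \<bar>f x (y + h) - f x y\<bar> \<le> 2 * \<bar>\<phi> x\<bar> * h powr (\<alpha> - d)"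
    using x AE_lborel_shift[OF x, of h]
  proof eventually_elim
    case (elim y)
    show ?case
    proof (cases "h \<le> 1")
      case True
      have "\<bar>f x (y + h) - f x y\<bar> \<le> \<phi> x * h powr \<alpha>"
        using holder_x[OF elim(2,1)] h by simp
      also have "\<dots> \<le> 2 * \<bar>\<phi> x\<bar> * h powr (\<alpha> - d)"
        using True h d by (intro mult_mono powr_mono') auto
      finally show ?thesis .
    next
      case False
      have "\<bar>f x (y + h) - f x y\<bar> \<le> 2 * \<bar>\<phi> x\<bar> * 1"
        using bound[OF elim(1)] bound[OF elim(2)] by linarith
      also have "\<dots> \<le> 2 * \<bar>\<phi> x\<bar> * h powr (\<alpha> - d)"
        using False d by (intro mult_left_mono ge_one_powr_ge_zero) auto
      finally show ?thesis .
    qed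
  qed
qed

text \<open>For almost every \<open>x\<close>, a section norm above \<open>r\<close> forces
  \<open>\<phi> x\<close> above \<open>rearr \<phi> s\<close>, by the contrapositive of
  \<open>lip_norm_section_le\<close>; such \<open>x\<close> form a set of measure at most
  \<open>s\<close>.\<close>

lemma distrib_lip_norm_le:
  assumes s: "s > 0" and m: "AE x in lborel. f x \<in> borel_measurable lebesgue"
    and d: "0 < d" "d < \<alpha>" and r: "0 \<le> r" "10 * dyadic_sum d s \<le> ennreal r"
  shows "distrib_fun (\<lambda>x. lip_norm (\<alpha> - d) (f x)) r \<le> ennreal s"
proof -
  have "10 * dyadic_sum d s \<le> 10 * ennreal (r / 10)"
    using r by (simp flip: ennreal_numeral ennreal_mult)
  then have r': "dyadic_sum d s \<le> ennreal (r / 10)"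
    by (subst (asm) ennreal_mult_le_mult_iff) auto
  have "distrib_fun (\<lambda>x. lip_norm (\<alpha> - d) (f x)) r \<le> distrib_fun \<phi> (rearr \<phi> s)"
    unfolding distrib_fun_def
  proof (rule emeasure_mono_AE)
    show "AE x in lebesgue. x \<in> {t. r < \<bar>lip_norm (\<alpha> - d) (f t)\<bar>} \<longrightarrow> x \<in> {t. rearr \<phi> s < \<bar>\<phi> t\<bar>}"
      unfolding AE_completion_iff using AE_E(1) m
    proof eventually_elim
      case (elim x)
      then show ?case
        using lip_norm_section_le[OF s elim(1) _ elim(2) d _ r'] r(1) lip_norm_nonneg[of "\<alpha> - d" "f x"]
        by force
    qed
    show "{t. rearr \<phi> s < \<bar>\<phi> t\<bar>} \<in> sets lebesgue"
      using S0(1) by (intro sets_superlevel_abs) (simp add: in_S0_def)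
  qed
  also have "\<dots> \<le> ennreal s" by (rule distrib_fun_rearr[OF S0(1) s])
  finally show ?thesis .
qed

lemma rearr_lip_norm_le:
  assumes s: "s > 0" and m: "AE x in lborel. f x \<in> borel_measurable lebesgue"
    and d: "0 < d" "d < \<alpha>"
  shows "ennreal (rearr (\<lambda>x. lip_norm (\<alpha> - d) (f x)) s) \<le> 10 * dyadic_sum d s"
proof (cases "10 * dyadic_sum d s")
  case (real r)
  then show ?thesis
    using distrib_lip_norm_le[OF s m d, of r] by (auto intro!: ennreal_leI rearr_le)
qed (simp add: top_unique)

section \<open>Integration of the dyadic sum and the Lorentz bound\<close>

lemma measurable_\<Phi>: "(\<lambda>t. indicator {0<..} t * \<Phi> t) \<in> borel_measurable borel"
  using borel_measurable_add[OF measurable_rearr[OF S0(1)] measurable_rearr[OF S0(2)]]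
  by (simp add: \<Phi>_def distrib_left)

text \<open>Each term of the integrand is a constant times one fixed function \<open>g\<close>
  evaluated at 2^k s. This gives measurability, and the substitution t = 2^k s produces the
  geometric series.\<close>

lemma
  assumes b: "b = \<alpha> - d" "0 < b"
  shows measurable_dyadic_sum:
      "(\<lambda>s. indicator {0<..} s * (ennreal (s powr (b - 1)) * dyadic_sum d s)) \<in> borel_measurable borel"
      (is ?meas)
    and nn_integral_dyadic_sum: "(\<integral>\<^sup>+ s. indicator {0<..} s * (ennreal (s powr (b - 1)) * dyadic_sum d s) \<partial>lborel) =
    ennreal (1 / (1 - 2 powr (- b))) * (\<integral>\<^sup>+ t. indicator {0<..} t * ennreal (t powr (\<alpha> - 1) * \<Phi> t) \<partial>lborel)"
      (is ?int)
proof -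
  define g where "g t = indicator {0<..} t * ennreal (t powr (\<alpha> - 1) * \<Phi> t)" for t
  \<comment> \<open>The indicator is moved next to \<open>\<Phi>\<close> because
    \<open>measurable_\<Phi>\<close> speaks of that product only.\<close>
  have g': "g t = ennreal (t powr (\<alpha> - 1) * (indicator {0<..} t * \<Phi> t))" for t
    by (auto simp: g_def indicator_def)
  have g[measurable]: "g \<in> borel_measurable borel"
    unfolding g' using measurable_\<Phi> by measurable
  define F where "F k s = indicator {0<..} s * (ennreal (s powr (b - 1)) * ennreal ((2 ^ k * s) powr d * \<Phi> (2 ^ k * s)))"
    for k :: nat and s :: real
  have F: "F k s = ennreal ((2 ^ k) powr (1 - b)) * g (2 ^ k * s)" for k s
  proof (cases "s > 0")
    case True
    have nn: "0 \<le> \<Phi> (2 ^ k * s)" using True by (intro \<Phi>_nonneg) auto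
    \<comment> \<open>A factor 2^(k(b-1)) is inserted and compensated, so that the exponents b - 1
      and d combine to \<alpha> - 1 on the common base 2^k s.\<close>
    have "s powr (b - 1) * (2 ^ k * s) powr d =
        (2 ^ k) powr (1 - b) * ((2 ^ k) powr (b - 1) * s powr (b - 1) * (2 ^ k * s) powr d)"
      by (simp flip: powr_add mult.assoc)
    also have "\<dots> = (2 ^ k) powr (1 - b) * (2 ^ k * s) powr (\<alpha> - 1)"
      using True b by (simp flip: powr_mult powr_add)
    finally have *: "s powr (b - 1) * (2 ^ k * s) powr d = (2 ^ k) powr (1 - b) * (2 ^ k * s) powr (\<alpha> - 1)" .
    have "s powr (b - 1) * ((2 ^ k * s) powr d * \<Phi> (2 ^ k * s)) =
        (2 ^ k) powr (1 - b) * ((2 ^ k * s) powr (\<alpha> - 1) * \<Phi> (2 ^ k * s))"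
      using * by (simp flip: mult.assoc)
    then show ?thesis using True nn by (simp add: F_def g_def flip: ennreal_mult)
  qed (auto simp: F_def g_def zero_less_mult_iff)
  have Fm[measurable]: "F k \<in> borel_measurable borel" for k
    unfolding F[abs_def] by measurable
  have int_F: "(\<integral>\<^sup>+ s. F k s \<partial>lborel) = ennreal ((2 powr (- b)) ^ k) * (\<integral>\<^sup>+ t. g t \<partial>lborel)" for k
  proof -
    have "(\<integral>\<^sup>+ t. g t \<partial>lborel) = ennreal (2 ^ k) * (\<integral>\<^sup>+ s. g (2 ^ k * s) \<partial>lborel)"
      using nn_integral_real_affine[OF g, of "2 ^ k" 0] by simp
    then have "ennreal ((2 powr (- b)) ^ k) * (\<integral>\<^sup>+ t. g t \<partial>lborel) =
        ennreal ((2 powr (- b)) ^ k * 2 ^ k) * (\<integral>\<^sup>+ s. g (2 ^ k * s) \<partial>lborel)"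
      by (simp add: ennreal_mult mult.assoc)
    also have "(2 powr (- b)) ^ k * 2 ^ k = (2 ^ k) powr (1 - b)"
      by (simp add: powr_diff powr_minus powr_power power_inverse powr_realpow[symmetric] powr_powr divide_inverse mult.commute)
    also have "ennreal ((2 ^ k) powr (1 - b)) * (\<integral>\<^sup>+ s. g (2 ^ k * s) \<partial>lborel) = (\<integral>\<^sup>+ s. F k s \<partial>lborel)"
      unfolding F by (subst nn_integral_cmult) auto
    finally show ?thesis ..
  qed
  have sum_F: "indicator {0<..} s * (ennreal (s powr (b - 1)) * dyadic_sum d s) = (\<Sum>k. F k s)" for s
    unfolding F_def dyadic_sum_def by (simp add: mult.assoc)
  show ?meas unfolding sum_F by measurable
  have "(\<integral>\<^sup>+ s. indicator {0<..} s * (ennreal (s powr (b - 1)) * dyadic_sum d s) \<partial>lborel) =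
      (\<integral>\<^sup>+ s. (\<Sum>k. F k s) \<partial>lborel)"
    unfolding sum_F ..
  also have "\<dots> = (\<Sum>k. \<integral>\<^sup>+ s. F k s \<partial>lborel)"
    by (rule nn_integral_suminf) simp
  also have "\<dots> = (\<Sum>k. ennreal ((2 powr (- b)) ^ k)) * (\<integral>\<^sup>+ t. g t \<partial>lborel)"
    unfolding int_F by simp
  also have "(\<Sum>k. ennreal ((2 powr (- b)) ^ k)) = ennreal (1 / (1 - 2 powr (- b)))"
  proof -
    have "(2 :: real) powr (- b) < 2 powr 0" using b by (intro powr_less_mono) auto
    then have "\<bar>(2 :: real) powr (- b)\<bar> < 1" by simp
    then show ?thesis
      by (intro suminf_ennreal_eq geometric_sums[of "2 powr (- b)", simplified]) auto
  qed
  finally show ?int unfolding g_def .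
qed

lemma nn_integral_\<Phi>:
  "(\<integral>\<^sup>+ t. indicator {0<..} t * ennreal (t powr (\<alpha> - 1) * \<Phi> t) \<partial>lborel) =
    lorentz_p1_norm (1 / \<alpha>) \<phi> + lorentz_p1_norm (1 / \<alpha>) \<psi>"
proof -
  have m: "(\<lambda>t. indicator {0<..} t * ennreal (t powr (\<alpha> - 1) * rearr g t)) \<in> borel_measurable borel"
    if "in_S0 g" for g
  proof -
    have "(\<lambda>t. ennreal (t powr (\<alpha> - 1) * (indicator {0<..} t * rearr g t))) \<in> borel_measurable borel"
      using measurable_rearr[OF that] by measurable
    also have "(\<lambda>t. ennreal (t powr (\<alpha> - 1) * (indicator {0<..} t * rearr g t))) =
        (\<lambda>t. indicator {0<..} t * ennreal (t powr (\<alpha> - 1) * rearr g t))"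
      by (auto simp: indicator_def)
    finally show ?thesis .
  qed
  have "(\<integral>\<^sup>+ t. indicator {0<..} t * ennreal (t powr (\<alpha> - 1) * \<Phi> t) \<partial>lborel) =
    (\<integral>\<^sup>+ t. indicator {0<..} t * ennreal (t powr (\<alpha> - 1) * rearr \<phi> t) +
      indicator {0<..} t * ennreal (t powr (\<alpha> - 1) * rearr \<psi> t) \<partial>lborel)"
    by (intro nn_integral_cong)
      (auto simp: indicator_def \<Phi>_def distrib_left rearr_nonneg[OF S0(1)] rearr_nonneg[OF S0(2)] simp flip: ennreal_plus)
  then show ?thesis
    using m[OF S0(1)] m[OF S0(2)] by (simp add: nn_integral_add lorentz_p1_norm_def)
qed

text \<open>With \<alpha> = 1/p and \<alpha> - d = 1/q this is the norm estimate for one of the two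
  families of sections.\<close>

lemma lorentz_lip_norm_le:
  assumes m: "AE x in lborel. f x \<in> borel_measurable lebesgue" and d: "0 < d" "d < \<alpha>"
  shows "lorentz_p1_norm (1 / (\<alpha> - d)) (\<lambda>x. lip_norm (\<alpha> - d) (f x)) \<le>
    ennreal (10 / (1 - 2 powr (d - \<alpha>))) * (lorentz_p1_norm (1 / \<alpha>) \<phi> + lorentz_p1_norm (1 / \<alpha>) \<psi>)"
    (is "?L \<le> _ * ?N")
proof -
  define b where "b = \<alpha> - d"
  have b: "b > 0" using d by (simp add: b_def)
  have "?L \<le> (\<integral>\<^sup>+ s. 10 * (indicator {0<..} s * (ennreal (s powr (b - 1)) * dyadic_sum d s)) \<partial>lborel)"
    unfolding lorentz_p1_norm_def
  proof (rule nn_integral_mono)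
    fix s :: real
    show "indicator {0<..} s * ennreal (s powr (1 / (1 / (\<alpha> - d)) - 1) * rearr (\<lambda>x. lip_norm (\<alpha> - d) (f x)) s) \<le>
      10 * (indicator {0<..} s * (ennreal (s powr (b - 1)) * dyadic_sum d s))"
      using mult_left_mono[OF rearr_lip_norm_le[OF _ m d, of s], of "ennreal (s powr (b - 1))"]
      by (auto simp: indicator_def b_def ennreal_mult' mult_ac)
  qed
  also have "\<dots> = 10 * (\<integral>\<^sup>+ s. indicator {0<..} s * (ennreal (s powr (b - 1)) * dyadic_sum d s) \<partial>lborel)"
    using measurable_dyadic_sum[OF b_def b] by (intro nn_integral_cmult) simp
  also have "\<dots> = 10 * (ennreal (1 / (1 - 2 powr (- b))) * ?N)"
    by (simp add: nn_integral_dyadic_sum[OF b_def b] nn_integral_\<Phi>)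
  also have "\<dots> = ennreal (10 * (1 / (1 - 2 powr (- b)))) * ?N"
    by (subst ennreal_mult') (auto simp: mult.assoc)
  also have "10 * (1 / (1 - 2 powr (- b))) = 10 / (1 - 2 powr (d - \<alpha>))"
    by (simp add: b_def)
  finally show ?thesis .
qed

text \<open>An infinite distribution function at \<open>r\<close> would force
  \<open>dyadic_sum d s\<close> to be at least \<open>r / 10\<close> for every \<open>s > 0\<close>.
  Since s^(b-1) with \<open>b > 0\<close> is not integrable at infinity, this contradicts the finite
  integral of the dyadic sum.\<close>

lemma in_S0_lip_norm:
  assumes m: "AE x in lborel. f x \<in> borel_measurable lebesgue" and d: "0 < d" "d < \<alpha>"
    and G: "(\<lambda>x. lip_norm (\<alpha> - d) (f x)) \<in> borel_measurable lebesgue"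
    and fin: "lorentz_p1_norm (1 / \<alpha>) \<phi> < \<infinity>" "lorentz_p1_norm (1 / \<alpha>) \<psi> < \<infinity>"
  shows "in_S0 (\<lambda>x. lip_norm (\<alpha> - d) (f x))"
  unfolding in_S0_def
proof (intro conjI allI impI)
  fix r :: real assume r: "r > 0"
  define b where "b = \<alpha> - d"
  have b: "b > 0" using d by (simp add: b_def)
  let ?I = "\<lambda>s. indicator {0<..} s * (ennreal (s powr (b - 1)) * dyadic_sum d s)"
  show "distrib_fun (\<lambda>x. lip_norm (\<alpha> - d) (f x)) r < \<infinity>"
  proof (rule ccontr)
    assume *: "\<not> ?thesis"
    have large: "ennreal (r / 10) \<le> dyadic_sum d s" if "s > 0" for s
    proof (rule ccontr)
      assume "\<not> ennreal (r / 10) \<le> dyadic_sum d s"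
      then have "10 * dyadic_sum d s \<le> 10 * ennreal (r / 10)" by (intro mult_left_mono) auto
      also have "\<dots> = ennreal r" using r by (simp flip: ennreal_numeral ennreal_mult)
      finally have "distrib_fun (\<lambda>x. lip_norm (\<alpha> - d) (f x)) r \<le> ennreal s"
        using r by (intro distrib_lip_norm_le[OF that m d]) auto
      with * show False by (simp add: top_unique not_less)
    qed
    have "(\<integral>\<^sup>+ s. ?I s \<partial>lborel) < \<infinity>"
      using fin by (simp add: nn_integral_dyadic_sum[OF b_def b] nn_integral_\<Phi> ennreal_mult_less_top)
    then obtain C where C: "C \<ge> 0" "(\<integral>\<^sup>+ s. ?I s \<partial>lborel) = ennreal C"
      by (cases "\<integral>\<^sup>+ s. ?I s \<partial>lborel") auto
    \<comment> \<open>\<open>R\<close> is chosen so that \<open>r / 10\<close> times the integral of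
      s^(b-1) over [1, R] is exactly \<open>C + 1\<close>; starting at 1 avoids the singularity at
      0.\<close>
    define R where "R = (1 + 10 * b * (C + 1) / r) powr (1 / b)"
    have R: "R powr b = 1 + 10 * b * (C + 1) / r"
      using b r C(1) by (simp add: R_def powr_powr)
    have "1 \<le> R"
      unfolding R_def using b r C(1) by (intro ge_one_powr_ge_zero) auto
    have "((R powr b - 1) / b) * (r / 10) = C + 1"
      using b r by (simp add: R)
    moreover have "((R powr b - 1) / b) * (r / 10) = r / 10 * (R powr b / b) - r / 10 * (1 powr b / b)"
      by (simp add: diff_divide_distrib right_diff_distrib mult.commute)
    ultimately have "ennreal (C + 1) = ennreal (r / 10 * (R powr b / b) - r / 10 * (1 powr b / b))"
      by simp
    also have "\<dots> = (\<integral>\<^sup>+ s. ennreal (r / 10 * s powr (b - 1)) * indicator {1..R} s \<partial>lborel)"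
      using b r \<open>1 \<le> R\<close>
      by (intro nn_integral_FTC_Icc[symmetric]) (auto intro!: derivative_eq_intros)
    also have "\<dots> \<le> (\<integral>\<^sup>+ s. ?I s \<partial>lborel)"
    proof (rule nn_integral_mono)
      fix s
      have "ennreal (r / 10 * s powr (b - 1)) = ennreal (s powr (b - 1)) * ennreal (r / 10)"
        using r by (subst mult.commute, intro ennreal_mult) auto
      then show "ennreal (r / 10 * s powr (b - 1)) * indicator {1..R} s \<le> ?I s"
        using mult_left_mono[OF large, of s "ennreal (s powr (b - 1))"]
        by (simp add: indicator_def)
    qed
    finally show False using C by simp
  qed
qed (rule G)

end

section \<open>Measurability of the Lipschitz norm of a section\<close>

lemma measurable_section:
  assumes F: "(\<lambda>z. F (fst z) (snd z)) \<in> borel_measurable (borel \<Otimes>\<^sub>M borel)"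
  shows "F x \<in> borel_measurable borel" "(\<lambda>x. F x y) \<in> borel_measurable borel"
proof -
  have "(\<lambda>y. F (fst (x, y)) (snd (x, y))) \<in> borel_measurable borel"
    by (rule measurable_compose[OF measurable_Pair1' F]) simp
  then show "F x \<in> borel_measurable borel" by simp
  have "(\<lambda>x. F (fst (x, y)) (snd (x, y))) \<in> borel_measurable borel"
    by (rule measurable_compose[OF measurable_Pair2' F]) simp
  then show "(\<lambda>x. F x y) \<in> borel_measurable borel" by simp
qed

text \<open>A sublevel set is given by an almost-everywhere condition in \<open>y\<close>, which
  depends measurably on \<open>x\<close> by \<open>pred_AE_lborel\<close>.\<close>

lemma measurable_linf_norm_sections:
  fixes F :: "real \<Rightarrow> real \<Rightarrow> real"
  assumes F[measurable]: "(\<lambda>z. F (fst z) (snd z)) \<in> borel_measurable (borel \<Otimes>\<^sub>M borel)"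
  shows "(\<lambda>x. linf_norm (F x)) \<in> borel_measurable borel"
proof -
  have Fx: "F x \<in> borel_measurable lebesgue" for x
    using measurable_section(1)[OF F] by (intro measurable_completion) simp
  have "{x. linf_norm (F x) \<le> a} \<in> sets borel" for a
  proof (cases a)
    case (real c)
    have "Measurable.pred borel (\<lambda>x. AE y in lborel. \<bar>F x y\<bar> \<le> c)"
      by (rule pred_AE_lborel) measurable
    then show ?thesis by (simp add: real linf_norm_le_iff[OF Fx] pred_def)
  next
    case MInf
    then have "{x. linf_norm (F x) \<le> a} = {}" using linf_norm_nonneg
      by (metis (no_types, lifting) Collect_empty_eq MInfty_neq_ereal(1) ereal_infty_less_eq(2) leD
          ereal_less(5) infinity_ereal_def order_trans zero_ereal_def)
    then show ?thesis by simp
  qed simp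
  then show ?thesis
    by (intro borel_measurable_iff_Iic_ereal[THEN iffD2] allI) (simp add: vimage_def)
qed

text \<open>A countable supremum preserves measurability in a parameter. A general \<open>h\<close>
  is approached by rationals; no continuity of \<open>u\<close> is given, but \<open>u\<close> is
  Hoelder on a conull set, which is enough for the limit.\<close>

lemma lip_seminorm_eq_SUP_rat:
  assumes a: "\<alpha> > 0" and u: "u \<in> borel_measurable borel" "in_Lip \<alpha> u"
  shows "lip_seminorm \<alpha> u = (SUP h\<in>{0<..} \<inter> \<rat>. ereal (h powr (- \<alpha>)) * linf_norm (diff_op h u))"
    (is "_ = ?R")
proof (rule antisym)
  show "?R \<le> lip_seminorm \<alpha> u"
    unfolding lip_seminorm_def by (intro SUP_subset_mono) auto
  have m: "u \<in> borel_measurable lebesgue" using u(2) by (simp add: in_Lip_def)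
  have "ereal (1 powr (- \<alpha>)) * linf_norm (diff_op 1 u) \<le> ?R"
    by (rule SUP_upper) auto
  then have "0 \<le> ?R" using linf_norm_nonneg[of "diff_op 1 u"] by simp
  moreover have "?R < \<infinity>"
    using \<open>?R \<le> lip_seminorm \<alpha> u\<close> u(2) by (auto simp: in_Lip_def)
  ultimately obtain c where c: "?R = ereal c" "c \<ge> 0" by (cases ?R) auto
  have rat: "AE t in lborel. \<bar>u (t + h) - u t\<bar> \<le> c * h powr \<alpha>" if "h > 0" "h \<in> \<rat>" for h
  proof -
    have "ereal (h powr (- \<alpha>)) * linf_norm (diff_op h u) \<le> ereal c"
      unfolding c(1)[symmetric] using that by (intro SUP_upper) auto
    then have "linf_norm (diff_op h u) \<le> ereal (c * h powr \<alpha>)"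
      using that by (cases "linf_norm (diff_op h u)") (auto simp: powr_minus field_simps)
    then show ?thesis by (simp add: linf_norm_le_iff diff_op_measurable m diff_op_def)
  qed
  define M where "M = lip_norm \<alpha> u"
  define A where "A y \<longleftrightarrow> (AE t in lborel. \<bar>u y - u t\<bar> \<le> M * \<bar>y - t\<bar> powr \<alpha>)" for y
  have A: "AE y in lborel. A y"
    unfolding A_def M_def by (rule AE_Holder_pairs[OF u(1) in_LipD(2)[OF u(2)]])
  have AA: "\<bar>u y - u y'\<bar> \<le> M * \<bar>y - y'\<bar> powr \<alpha>" if "A y" "A y'" for y y'
    using that unfolding A_def by (rule Holder_of_AE[OF a])
  have "AE t in lborel. \<bar>u (t + h) - u t\<bar> \<le> c * h powr \<alpha>" if "h > 0" for h
  proof -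
    have "\<exists>k. k \<in> \<rat> \<and> h < k \<and> k < h + 1 / Suc n" for n :: nat
      using Rats_dense_in_real[of h "h + 1 / Suc n"] by auto
    then obtain k :: "nat \<Rightarrow> real" where k: "\<And>n. k n \<in> \<rat>" "\<And>n. h < k n" "\<And>n. k n < h + 1 / Suc n"
      by metis
    have "norm (k n - h) \<le> inverse (real (Suc n))" for n
      using k(2,3)[of n] by (simp add: inverse_eq_divide)
    then have "(\<lambda>n. k n - h) \<longlonglongrightarrow> 0"
      by (intro Lim_null_comparison[OF _ LIMSEQ_inverse_real_of_nat] always_eventually) simp
    then have klim: "k \<longlonglongrightarrow> h" by (simp add: LIM_zero_iff)
    \<comment> \<open>Countably many exceptional sets are merged, so that one \<open>t\<close>
      serves all \<open>k n\<close>.\<close>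
    have "AE t in lborel. \<forall>n. A (t + k n) \<and> \<bar>u (t + k n) - u t\<bar> \<le> c * k n powr \<alpha>"
      unfolding AE_all_countable
    proof
      fix n
      have "k n > 0" using k(2)[of n] that by simp
      then show "AE t in lborel. A (t + k n) \<and> \<bar>u (t + k n) - u t\<bar> \<le> c * k n powr \<alpha>"
        using AE_lborel_shift[OF A, of "k n"] rat[OF _ k(1)] by (intro AE_conjI)
    qed
    then show ?thesis using AE_lborel_shift[OF A, of h]
    proof eventually_elim
      case (elim t)
      \<comment> \<open>The full norm \<open>M\<close> enters only the error term, which tends to 0;
        the limit retains the rational constant \<open>c\<close>.\<close>
      have "\<bar>u (t + h) - u t\<bar> \<le> M * \<bar>h - k n\<bar> powr \<alpha> + c * k n powr \<alpha>" for n
      proof -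
        have "\<bar>u (t + h) - u (t + k n)\<bar> \<le> M * \<bar>h - k n\<bar> powr \<alpha>"
          using AA[of "t + h" "t + k n"] elim by simp
        moreover have "\<bar>u (t + k n) - u t\<bar> \<le> c * k n powr \<alpha>" using elim by simp
        ultimately show ?thesis by linarith
      qed
      moreover have "(\<lambda>n. M * \<bar>h - k n\<bar> powr \<alpha> + c * k n powr \<alpha>) \<longlonglongrightarrow>
          M * \<bar>h - h\<bar> powr \<alpha> + c * h powr \<alpha>"
        using a that by (intro tendsto_intros tendsto_powr' klim) auto
      ultimately show ?case using LIMSEQ_le_const by fastforce
    qed
  qed
  then have "lip_seminorm \<alpha> u \<le> ereal c"
    by (simp add: lip_seminorm_le_iff[OF m])
  then show "lip_seminorm \<alpha> u \<le> ?R" using c(1) by simp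
qed

lemma lip_cong_AE:
  assumes "u \<in> borel_measurable lebesgue" "AE t in lborel. u t = v t"
  shows "in_Lip \<alpha> u \<longleftrightarrow> in_Lip \<alpha> v" "lip_norm \<alpha> u = lip_norm \<alpha> v"
proof -
  have v: "v \<in> borel_measurable lebesgue"
    using assms by (rule borel_measurable_lebesgue_cong_AE)
  have "linf_norm (diff_op h u) = linf_norm (diff_op h v)" for h
    using assms(2) AE_lborel_shift[OF assms(2), of h]
    by (intro linf_norm_cong_AE diff_op_measurable assms(1)) (auto simp: diff_op_def)
  then have "lip_seminorm \<alpha> u = lip_seminorm \<alpha> v" by (simp add: lip_seminorm_def)
  then show "in_Lip \<alpha> u \<longleftrightarrow> in_Lip \<alpha> v" "lip_norm \<alpha> u = lip_norm \<alpha> v"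
    using linf_norm_cong_AE[OF assms] v assms(1) by (simp_all add: in_Lip_def lip_norm_def)
qed

lemma ex_borel_version:
  fixes f :: "real \<times> real \<Rightarrow> real"
  assumes "f \<in> borel_measurable lebesgue"
  obtains g where "(\<lambda>z. g (fst z) (snd z)) \<in> borel_measurable (borel \<Otimes>\<^sub>M borel)"
    "AE x in lborel. AE y in lborel. f (x, y) = g x y"
    "AE y in lborel. AE x in lborel. f (x, y) = g x y"
proof -
  obtain g where g: "g \<in> borel_measurable lborel" "AE z in lborel. f z = g z"
    using completion_ex_borel_measurable_real[OF assms] by blast
  show ?thesis
  proof (rule that[of "curry g"])
    show "(\<lambda>z. curry g (fst z) (snd z)) \<in> borel_measurable (borel \<Otimes>\<^sub>M borel)"
      using g(1) by (simp add: borel_prod)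
  qed (use AE_lborel_prodD[OF g(2)] in simp_all)
qed

text \<open>This supplies the measurability inside \<open>in_S0\<close> for the exponent
  \<open>1 / q\<close>. On a Borel version of \<open>f\<close> the norm is a Borel expression
  through rational increments, and it agrees with the original norm for almost every
  \<open>x\<close>.\<close>

lemma measurable_lip_norm_sections:
  fixes f :: "real \<times> real \<Rightarrow> real"
  assumes f: "f \<in> borel_measurable lebesgue" and a: "\<alpha> > 0"
    and L: "AE x in lborel. in_Lip \<alpha> (\<lambda>y. f (x, y))"
  shows "(\<lambda>x. lip_norm \<alpha> (\<lambda>y. f (x, y))) \<in> borel_measurable lebesgue"
proof -
  obtain g where g[measurable]: "(\<lambda>z. g (fst z) (snd z)) \<in> borel_measurable (borel \<Otimes>\<^sub>M borel)"
    and fg: "AE x in lborel. AE y in lborel. f (x, y) = g x y"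
    using ex_borel_version[OF f] by blast
  let ?G = "\<lambda>x. real_of_ereal (linf_norm (g x) +
    (SUP h\<in>{0<..} \<inter> \<rat>. ereal (h powr (- \<alpha>)) * linf_norm (diff_op h (g x))))"
  have "(\<lambda>x. linf_norm (diff_op h (g x))) \<in> borel_measurable borel" for h
  proof (rule measurable_linf_norm_sections)
    have "(\<lambda>z. (\<lambda>z. g (fst z) (snd z)) (fst z, snd z + h) - g (fst z) (snd z))
        \<in> borel_measurable (borel \<Otimes>\<^sub>M borel)"
      by measurable
    then show "(\<lambda>z. diff_op h (g (fst z)) (snd z)) \<in> borel_measurable (borel \<Otimes>\<^sub>M borel)"
      by (simp add: diff_op_def)
  qed
  then have "?G \<in> borel_measurable borel"
    using measurable_linf_norm_sections[OF g] countable_rat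
    by (intro borel_measurable_real_of_ereal borel_measurable_ereal_add borel_measurable_SUP
        borel_measurable_ereal_times borel_measurable_const) (auto intro: countable_subset)
  then have "?G \<in> borel_measurable lebesgue" by (intro measurable_completion) simp
  moreover have "AE x in lborel. ?G x = lip_norm \<alpha> (\<lambda>y. f (x, y))"
    using fg L
  proof eventually_elim
    case (elim x)
    have m: "(\<lambda>y. f (x, y)) \<in> borel_measurable lebesgue" using elim by (simp add: in_Lip_def)
    note cong = lip_cong_AE[OF m, of "g x", OF elim(1), of \<alpha>]
    have "in_Lip \<alpha> (g x)" using cong(1) elim(2) by simp
    from lip_seminorm_eq_SUP_rat[OF a measurable_section(1)[OF g] this] cong(2)
    show ?case by (simp add: lip_norm_def)
  qed
  ultimately show ?thesis by (rule borel_measurable_lebesgue_cong_AE)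
qed

section \<open>Construction of the conull relation\<close>

text \<open>With \<open>g\<close> and \<open>u\<close> Borel, \<open>P\<close> is a measurable
  predicate on the plane, so its validity almost everywhere passes from one order of the variables
  to the other.\<close>

lemma section_Holder_AE:
  fixes g :: "real \<Rightarrow> real \<Rightarrow> real" and u :: "real \<Rightarrow> real"
  assumes g[measurable]: "(\<lambda>z. g (fst z) (snd z)) \<in> borel_measurable (borel \<Otimes>\<^sub>M borel)"
    and u[measurable]: "u \<in> borel_measurable borel"
    and H: "AE x in lborel. \<forall>h>0. AE y in lborel. \<bar>g x (y + h) - g x y\<bar> \<le> u x * h powr \<alpha>"
  defines "P x y \<equiv> AE y' in lborel. \<bar>g x y - g x y'\<bar> \<le> u x * \<bar>y - y'\<bar> powr \<alpha>"
  shows "AE x in lborel. AE y in lborel. P x y" "AE y in lborel. AE x in lborel. P x y"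
proof -
  show 1: "AE x in lborel. AE y in lborel. P x y"
    using H unfolding P_def
    by eventually_elim (rule AE_Holder_pairs[OF measurable_section(1)[OF g]], blast)
  have "Measurable.pred (borel \<Otimes>\<^sub>M borel) (\<lambda>z. P (fst z) (snd z))"
    unfolding P_def
  proof (rule pred_AE_lborel)
    have "Measurable.pred ((borel \<Otimes>\<^sub>M borel) \<Otimes>\<^sub>M borel)
      (\<lambda>w. \<bar>g (fst (fst w)) (snd (fst w)) - (\<lambda>z. g (fst z) (snd z)) (fst (fst w), snd w)\<bar>
          \<le> u (fst (fst w)) * \<bar>snd (fst w) - snd w\<bar> powr \<alpha>)"
      by measurable
    then show "Measurable.pred ((borel \<Otimes>\<^sub>M borel) \<Otimes>\<^sub>M borel)
      (\<lambda>w. \<bar>g (fst (fst w)) (snd (fst w)) - g (fst (fst w)) (snd w)\<bar>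
          \<le> u (fst (fst w)) * \<bar>snd (fst w) - snd w\<bar> powr \<alpha>)" by simp
  qed
  from borel_prod_AE_commute[OF this] 1 show "AE y in lborel. AE x in lborel. P x y" by simp
qed

lemma ex_holder_grid:
  assumes p: "1 \<le> p" and U: "in_U p f"
  shows "\<exists>E. holder_grid (\<lambda>x y. f (x, y)) (\<lambda>x. lip_norm (1 / p) (\<lambda>y. f (x, y)))
    (\<lambda>y. lip_norm (1 / p) (\<lambda>x. f (x, y))) E (1 / p)"
proof -
  define \<phi> where "\<phi> x = lip_norm (1 / p) (\<lambda>y. f (x, y))" for x
  define \<psi> where "\<psi> y = lip_norm (1 / p) (\<lambda>x. f (x, y))" for y
  have f: "f \<in> borel_measurable lebesgue"
    and Lx: "AE x in lborel. in_Lip (1 / p) (\<lambda>y. f (x, y))"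
    and Ly: "AE y in lborel. in_Lip (1 / p) (\<lambda>x. f (x, y))"
    and S0: "in_S0 \<phi>" "in_S0 \<psi>"
    using U by (simp_all add: in_U_def in_Lp1_def \<phi>_def[abs_def] \<psi>_def[abs_def] AE_completion_iff)
  obtain g where g[measurable]: "(\<lambda>z. g (fst z) (snd z)) \<in> borel_measurable (borel \<Otimes>\<^sub>M borel)"
    and fg: "AE x in lborel. AE y in lborel. f (x, y) = g x y"
      "AE y in lborel. AE x in lborel. f (x, y) = g x y"
    using ex_borel_version[OF f] by blast
  have "(\<lambda>z. (\<lambda>z. g (fst z) (snd z)) (snd z, fst z)) \<in> borel_measurable (borel \<Otimes>\<^sub>M borel)"
    by measurable
  then have g': "(\<lambda>z. g (snd z) (fst z)) \<in> borel_measurable (borel \<Otimes>\<^sub>M borel)" by simp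
  \<comment> \<open>The norm functions are only Lebesgue measurable; Borel versions \<open>u\<close>
    and \<open>v\<close> make the Fubini exchanges possible.\<close>
  obtain u where u[measurable]: "u \<in> borel_measurable borel" and \<phi>u: "AE x in lborel. \<phi> x = u x"
    using completion_ex_borel_measurable_real[of \<phi> lborel] S0(1) by (auto simp: in_S0_def)
  obtain v where v[measurable]: "v \<in> borel_measurable borel" and \<psi>v: "AE y in lborel. \<psi> y = v y"
    using completion_ex_borel_measurable_real[of \<psi> lborel] S0(2) by (auto simp: in_S0_def)
  have cong: "in_Lip (1 / p) b \<and> lip_norm (1 / p) a = lip_norm (1 / p) b"
    if "in_Lip (1 / p) a" "AE t in lborel. a t = b t" for a b
    using lip_cong_AE[of a b "1 / p"] that by (simp add: in_Lip_def)
  have gx: "AE x in lborel. in_Lip (1 / p) (g x) \<and> lip_norm (1 / p) (g x) = u x"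
    using Lx fg(1) \<phi>u
    by eventually_elim (use cong in \<open>fastforce simp: \<phi>_def\<close>)
  have gy: "AE y in lborel. in_Lip (1 / p) (\<lambda>x. g x y) \<and> lip_norm (1 / p) (\<lambda>x. g x y) = v y"
    using Ly fg(2) \<psi>v
    by eventually_elim (use cong in \<open>fastforce simp: \<psi>_def\<close>)
  define P where "P x y \<longleftrightarrow> (AE y' in lborel. \<bar>g x y - g x y'\<bar> \<le> u x * \<bar>y - y'\<bar> powr (1 / p))" for x y
  define Q where "Q x y \<longleftrightarrow> (AE x' in lborel. \<bar>g x y - g x' y\<bar> \<le> v y * \<bar>x - x'\<bar> powr (1 / p))" for x y
  have "AE x in lborel. \<forall>h>0. AE y in lborel. \<bar>g x (y + h) - g x y\<bar> \<le> u x * h powr (1 / p)"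
  proof (use gx in eventually_elim)
    case (elim x)
    then show ?case using in_LipD(2)[of "1 / p" "g x"] by auto
  qed
  note P = section_Holder_AE[OF g u this, folded P_def]
  have "AE y in lborel. \<forall>h>0. AE x in lborel. \<bar>g (x + h) y - g x y\<bar> \<le> v y * h powr (1 / p)"
  proof (use gy in eventually_elim)
    case (elim y)
    then show ?case using in_LipD(2)[of "1 / p" "\<lambda>x. g x y"] by auto
  qed
  \<comment> \<open>The coordinates are exchanged here, so \<open>Q(1)\<close> has \<open>y\<close>
    as the outer variable and \<open>Q(2)\<close> has \<open>x\<close>.\<close>
  note Q = section_Holder_AE[of "\<lambda>y x. g x y", OF g' v this, folded Q_def]
  have B1: "AE x in lborel. AE y in lborel. \<bar>g x y\<bar> \<le> u x"
  proof (use gx in eventually_elim)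
    case (elim x)
    then show ?case using in_LipD(1)[of "1 / p" "g x"] by auto
  qed
  have "Measurable.pred (borel \<Otimes>\<^sub>M borel) (\<lambda>z. \<bar>g (fst z) (snd z)\<bar> \<le> u (fst z))"
    by measurable
  from borel_prod_AE_commute[OF this] B1
  have B2: "AE y in lborel. AE x in lborel. \<bar>g x y\<bar> \<le> u x" by simp
  \<comment> \<open>\<open>P\<close> and \<open>Q\<close> are almost-everywhere bounds from one
    point; two points satisfying them on a common line obey the pointwise bound by
    \<open>Holder_of_AE\<close>. The equalities carry the bounds from \<open>g\<close>,
    \<open>u\<close>, \<open>v\<close> back to \<open>f\<close>, \<phi>, \<psi>.\<close>
  define E where "E x y \<longleftrightarrow> f (x, y) = g x y \<and> \<bar>g x y\<bar> \<le> u x \<and> P x y \<and> Q x y \<and>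
    \<phi> x = u x \<and> \<psi> y = v y" for x y
  have "holder_grid (\<lambda>x y. f (x, y)) \<phi> \<psi> E (1 / p)"
  proof
    show "AE x in lborel. AE y in lborel. E x y"
      using fg(1) B1 P(1) Q(2) \<phi>u
      by eventually_elim (use \<psi>v in \<open>simp add: E_def AE_conj_iff\<close>)
    show "AE y in lborel. AE x in lborel. E x y"
      using fg(2) B2 P(2) Q(1) \<psi>v
      by eventually_elim (use \<phi>u in \<open>simp add: E_def AE_conj_iff\<close>)
    show "\<bar>f (x, y)\<bar> \<le> \<phi> x" if "E x y" for x y
      using that by (simp add: E_def)
    show "\<bar>f (x, y) - f (x, y')\<bar> \<le> \<phi> x * \<bar>y - y'\<bar> powr (1 / p)" if "E x y" "E x y'" for x y y'
      using that Holder_of_AE[of "1 / p" "g x" y "u x" y'] p by (simp add: E_def P_def)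
    show "\<bar>f (x, y) - f (x', y)\<bar> \<le> \<psi> y * \<bar>x - x'\<bar> powr (1 / p)" if "E x y" "E x' y" for x x' y
      using that Holder_of_AE[of "1 / p" "\<lambda>x. g x y" x "v y" x'] p by (simp add: E_def Q_def)
  qed (use p S0 in auto)
  then show ?thesis unfolding \<phi>_def[abs_def] \<psi>_def[abs_def] by blast
qed

section \<open>The embedding for each family of sections\<close>

text \<open>Even one family needs the whole norm of \<open>f\<close> on the right, since the chains
  move in both directions.\<close>

lemma U_section_bounds:
  assumes p: "1 \<le> p" "p < q" and U: "in_U p f"
  shows "AE x in lebesgue. in_Lip (1 / q) (\<lambda>y. f (x, y))"
    and "lorentz_p1_norm q (\<lambda>x. lip_norm (1 / q) (\<lambda>y. f (x, y))) \<le>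
      ennreal (10 / (1 - 2 powr (- (1 / q)))) * U_norm p f" (is ?bound)
    and "in_Lp1 q (\<lambda>x. lip_norm (1 / q) (\<lambda>y. f (x, y)))"
proof -
  obtain E where "holder_grid (\<lambda>x y. f (x, y)) (\<lambda>x. lip_norm (1 / p) (\<lambda>y. f (x, y)))
    (\<lambda>y. lip_norm (1 / p) (\<lambda>x. f (x, y))) E (1 / p)"
    using ex_holder_grid[OF p(1) U] by blast
  then interpret holder_grid "\<lambda>x y. f (x, y)" "\<lambda>x. lip_norm (1 / p) (\<lambda>y. f (x, y))"
    "\<lambda>y. lip_norm (1 / p) (\<lambda>x. f (x, y))" E "1 / p" .
  define d where "d = 1 / p - 1 / q"
  have d: "0 < d" "d < 1 / p" and q: "1 / p - d = 1 / q" "d - 1 / p = - (1 / q)"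
    using p by (auto simp: d_def frac_less2)
  have m: "AE x in lborel. (\<lambda>y. f (x, y)) \<in> borel_measurable lebesgue"
    using U unfolding in_U_def AE_completion_iff by (auto simp: in_Lip_def elim: eventually_mono)
  have fin: "lorentz_p1_norm (1 / (1 / p)) (\<lambda>x. lip_norm (1 / p) (\<lambda>y. f (x, y))) < \<infinity>"
    "lorentz_p1_norm (1 / (1 / p)) (\<lambda>y. lip_norm (1 / p) (\<lambda>x. f (x, y))) < \<infinity>"
    using U by (simp_all add: in_U_def in_Lp1_def)
  have L: "AE x in lborel. in_Lip (1 / q) (\<lambda>y. f (x, y))"
    using AE_E(1) m by eventually_elim (use in_Lip_section[OF _ _ d] q in simp)
  then show "AE x in lebesgue. in_Lip (1 / q) (\<lambda>y. f (x, y))"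
    by (simp add: AE_completion_iff)
  show bound: ?bound
    using lorentz_lip_norm_le[OF m d] by (simp add: q U_norm_def add.commute)
  have "(\<lambda>x. lip_norm (1 / q) (\<lambda>y. f (x, y))) \<in> borel_measurable lebesgue"
    using U p L by (intro measurable_lip_norm_sections) (auto simp: in_U_def)
  then have "in_S0 (\<lambda>x. lip_norm (1 / q) (\<lambda>y. f (x, y)))"
    using in_S0_lip_norm[OF m d _ fin] by (simp add: q)
  moreover have "lorentz_p1_norm q (\<lambda>x. lip_norm (1 / q) (\<lambda>y. f (x, y))) < \<infinity>"
    using fin by (intro le_less_trans[OF bound]) (simp add: U_norm_def ennreal_mult_less_top)
  ultimately show "in_Lp1 q (\<lambda>x. lip_norm (1 / q) (\<lambda>y. f (x, y)))"
    by (simp add: in_Lp1_def)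
qed

lemma AE_lborel_swap:
  fixes P :: "real \<times> real \<Rightarrow> bool"
  assumes "AE z in lborel. P z"
  shows "AE z in lborel. P (prod.swap z)"
proof -
  have "AE z in lborel \<Otimes>\<^sub>M lborel. P z"
    using assms by (simp only: lborel_prod)
  then have "AE z in distr (lborel \<Otimes>\<^sub>M lborel) (lborel \<Otimes>\<^sub>M lborel) (\<lambda>(x::real, y::real). (y, x)). P z"
    by (simp only: lborel_pair.distr_pair_swap[symmetric])
  from AE_distrD[OF measurable_pair_swap' this] show ?thesis
    by (simp only: lborel_prod prod.swap_def case_prod_beta)
qed

text \<open>Exchanging the coordinates lets \<open>U_section_bounds\<close> treat the second family
  of sections as well.\<close>

lemma in_U_swap:
  assumes "in_U p f"
  shows "in_U p (f \<circ> prod.swap)"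
proof -
  obtain g where g: "g \<in> borel_measurable borel" "AE z in lborel. f z = g z"
    using completion_ex_borel_measurable_real[of f lborel] assms by (auto simp: in_U_def)
  have "prod.swap \<in> borel_measurable (borel :: (real \<times> real) measure)"
    by (intro borel_measurable_continuous_onI continuous_on_swap)
  then have "g \<circ> prod.swap \<in> borel_measurable lebesgue"
    using g(1) by (intro measurable_completion) (simp add: measurable_comp)
  moreover have "AE z in lborel. (g \<circ> prod.swap) z = (f \<circ> prod.swap) z"
    using AE_lborel_swap[OF g(2)] by eventually_elim simp
  ultimately have "f \<circ> prod.swap \<in> borel_measurable lebesgue"
    by (rule borel_measurable_lebesgue_cong_AE)
  then show ?thesis using assms by (simp add: in_U_def)
qed

theorem theorem3p1:
  fixes p q :: real
  assumes "1 \<le> p" and "p < q"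
  shows "\<exists>c>0. \<forall>f. in_U p f \<longrightarrow> in_U q f \<and> U_norm q f \<le> ennreal c * U_norm p f"
proof (intro exI[of _ "20 / (1 - 2 powr (- (1 / q)))"] conjI allI impI)
  \<comment> \<open>Each of the two families contributes \<open>?c\<close>, so the constant is twice
    it. It is positive because 2^(-1/q) < 1.\<close>
  let ?c = "10 / (1 - 2 powr (- (1 / q)))"
  have "(2 :: real) powr (- (1 / q)) < 2 powr 0"
    using assms by (intro powr_less_mono) auto
  then have c: "?c > 0" by simp
  then show "20 / (1 - 2 powr (- (1 / q))) > 0" by simp
  fix f assume U: "in_U p f"
  note x = U_section_bounds[OF assms U] and y = U_section_bounds[OF assms in_U_swap[OF U]]
  show "in_U q f"
    using x(1,3) y(1,3) U by (simp add: in_U_def)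
  have "U_norm q f \<le> ennreal ?c * U_norm p f + ennreal ?c * U_norm p f"
    unfolding U_norm_def[of q] using x(2) y(2)
    by (intro add_mono) (simp_all add: U_norm_def add.commute)
  also have "\<dots> = (ennreal ?c + ennreal ?c) * U_norm p f"
    by (simp add: distrib_right)
  also have "ennreal ?c + ennreal ?c = ennreal (20 / (1 - 2 powr (- (1 / q))))"
    using c by (simp flip: ennreal_plus)
  finally show "U_norm q f \<le> ennreal (20 / (1 - 2 powr (- (1 / q)))) * U_norm p f" .
qed

end
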